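(* For arbitrary distinct positive integers $k$, $l$ and every positive integer $n$, we have $$\lambda_{k,l}(\mathbb{Z}_n) = \max_{d\mid n} \left\{ \alpha_{k,l}(\mathbb{Z}_d) \cdot \frac{n}{d} \right\},$$ where the maximum runs over all positive divisors $d$ of $n$.
   Context: $\mathbb{Z}_n$ is the cyclic group of order $n$, written additively. For a positive integer $h$ and a subset $A$ of an abelian group, $hA$ denotes the set of all sums of $h$ (not necessarily distinct) elements of $A$. For distinct positive integers $k,l$, a subset $A$ is called $(k,l)$-sum-free if $kA\cap lA=\emptyset$. $\lambda_{k,l}(\mathbb{Z}_n)$ denotes the maximum size of a $(k,l)$-sum-free subset of $\mathbb{Z}_n$ (the empty set counts as $(k,l)$-sum-free). An arithmetic progression in $\mathbb{Z}_n$ is a subset of the form $\{a,a+b,\dots,a+c\cdot b\}$ with $a,b\in\mathbb{Z}_n$ and $c\ge 0$ an integer; $b$ is its difference. $\alpha_{k,l}(\mathbb{Z}_n)$ denotes the maximum size of a $(k,l)$-sum-free arithmetic progression in $\mathbb{Z}_n$, with $\alpha_{k,l}(\mathbb{Z}_n)=0$ if there is none. *)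

theory Defs
  imports "HOL-Algebra.Elementary_Groups" "HOL-Algebra.FiniteProduct"
begin

(* HOL-Algebra writes every group multiplicatively: in integer_mod_group n, i.e. Z_n for n > 0,
   the product is addition modulo n, so finprod is a sum and b [^] i is the multiple i * b. *)

definition fold_sumset :: "('a, 'm) monoid_scheme \<Rightarrow> nat \<Rightarrow> 'a set \<Rightarrow> 'a set" where
  "fold_sumset G h A = {finprod G f {..<h} | f. f \<in> {..<h} \<rightarrow> A}"

definition kl_sum_free :: "('a, 'm) monoid_scheme \<Rightarrow> nat \<Rightarrow> nat \<Rightarrow> 'a set \<Rightarrow> bool" where
  "kl_sum_free G k l A \<longleftrightarrow>
     A \<subseteq> carrier G \<and> fold_sumset G k A \<inter> fold_sumset G l A = {}"

definition arith_prog :: "('a, 'm) monoid_scheme \<Rightarrow> 'a set \<Rightarrow> bool" where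
  "arith_prog G A \<longleftrightarrow>
     (\<exists>a \<in> carrier G. \<exists>b \<in> carrier G. \<exists>c::nat.
        A = {a \<otimes>\<^bsub>G\<^esub> b [^]\<^bsub>G\<^esub> i | i::nat. i \<le> c})"

(* lambda_kl and alpha_kl are meant for finite groups, where the sets below are finite. *)

definition lambda_kl :: "nat \<Rightarrow> nat \<Rightarrow> ('a, 'm) monoid_scheme \<Rightarrow> nat" where
  "lambda_kl k l G = Max {card A | A. kl_sum_free G k l A}"

definition alpha_kl :: "nat \<Rightarrow> nat \<Rightarrow> ('a, 'm) monoid_scheme \<Rightarrow> nat" where
  "alpha_kl k l G =
     (if \<exists>A. arith_prog G A \<and> kl_sum_free G k l A
      then Max {card A | A. arith_prog G A \<and> kl_sum_free G k l A}
      else 0)"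

end

theory Submission
  imports Complex_Main Defs "HOL-Library.Set_Algebras" "HOL.Hull"
begin

text \<open>
The inequality \<open>\<ge>\<close> is clear: the preimage in \<open>\<int>\<^sub>n\<close> of a sum-free subset of \<open>\<int>\<^sub>d\<close> is
sum-free and \<open>n div d\<close> times as large (\<open>kl_sum_free_pullback\<close>). For the inequality \<open>\<le>\<close> one needs, for
each nonempty sum-free set \<open>A\<close> in \<open>\<int>\<^sub>n\<close>, a divisor \<open>d\<close> and a sum-free progression in \<open>\<int>\<^sub>d\<close>
whose preimage is at least as large as \<open>A\<close> (\<open>sum_free_le_progression\<close>).

The reason is that sums of a set \<open>A\<close> with \<open>m\<close> elements typically grow by at least \<open>m\<close> with every new
summand. If this happens, then \<open>kA - (l - 1)A\<close>, which is disjoint from \<open>A\<close>, has at least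
\<open>(k + l - 1) m\<close> elements, so \<open>(k + l) m \<le> n\<close>. Under this bound there is enough room to place a
sum-free interval of \<open>m\<close> elements in \<open>\<int>\<^sub>n\<close> (\<open>interval_progression\<close>).

If the growth is slower at some step, the theorem \<open>critical_pair\<close> describes \<open>A\<close>: either it is an
arithmetic progression itself, and there is nothing to do, or there is a nontrivial subgroup \<open>H\<close> such
that \<open>A\<close> meets several cosets of \<open>H\<close> and misses fewer than \<open>card H\<close> elements of their union. In the
latter case already the difference set \<open>A - A\<close> is a union of cosets of \<open>H\<close>
(\<open>difference_set_periodic\<close>). Then so is \<open>kA - lA\<close>, and since it does not contain \<open>0\<close>, it is disjoint
from \<open>H\<close>. So the image of \<open>A\<close> in the quotient by \<open>H\<close> is sum-free, and the quotient is a smaller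
cyclic group, to which induction applies. If \<open>A\<close> lies in a single coset of a proper subgroup, the
same argument is carried out in that subgroup, unless the whole coset is sum-free, in which case again
one passes to the quotient. These alternatives are collected in \<open>sum_free_trichotomy\<close>.

The critical pair theorem is proved with Hamidoune's isoperimetric method. One considers an atom, a
smallest set \<open>M\<close> among those that grow least when \<open>A\<close> is added. Distinct translates of an atom share
at most one element (\<open>atom_inter\<close>), so \<open>M\<close> is a subgroup or a Sidon set (\<open>atom_subgrp_or_sidon\<close>). A
Sidon set with three or more elements grows too fast to be an atom, except when \<open>M\<close> generates a
subgroup whose cosets \<open>A\<close> almost fills, and a Sidon set with two elements \<open>0\<close> and \<open>x\<close> forces \<open>A\<close> to
be composed of progressions with difference \<open>x\<close>.
\<close>

section \<open>Subgroups, translates and sumsets\<close>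

definition subgrp :: "'a::ab_group_add set \<Rightarrow> bool" where
  "subgrp H \<longleftrightarrow> 0 \<in> H \<and> (\<forall>x\<in>H. \<forall>y\<in>H. x - y \<in> H)"

lemma subgrp_zero: "subgrp H \<Longrightarrow> 0 \<in> H"
  by (simp add: subgrp_def)

lemma subgrp_diff: "subgrp H \<Longrightarrow> x \<in> H \<Longrightarrow> y \<in> H \<Longrightarrow> x - y \<in> H"
  by (simp add: subgrp_def)

lemma subgrp_uminus: "subgrp H \<Longrightarrow> x \<in> H \<Longrightarrow> - x \<in> H"
  using subgrp_diff[of H 0 x] subgrp_zero by auto

lemma subgrp_add: "subgrp H \<Longrightarrow> x \<in> H \<Longrightarrow> y \<in> H \<Longrightarrow> x + y \<in> H"
  using subgrp_diff[of H x "- y"] subgrp_uminus by auto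

lemma subgrp_hull: "subgrp (subgrp hull M)"
  by (rule hull_in) (auto simp: subgrp_def)

lemma mem_translate [simp]: "x \<in> M + {g} \<longleftrightarrow> x - g \<in> M" for x g :: "'a::ab_group_add"
  by (auto simp: set_plus_def) (metis diff_add_cancel)

lemma translate_subset: "subgrp K \<Longrightarrow> X \<subseteq> K \<Longrightarrow> g \<in> K \<Longrightarrow> X + {g} \<subseteq> K"
  by (auto elim!: set_plus_elim intro: subgrp_add)

lemma sumset_subset: "subgrp K \<Longrightarrow> X \<subseteq> K \<Longrightarrow> Y \<subseteq> K \<Longrightarrow> X + Y \<subseteq> K"
  by (auto elim!: set_plus_elim intro: subgrp_add)

lemma card_translate [simp]: "card (X + {g}) = card X" for g :: "'a::ab_group_add"
  by (rule card_plus_sing)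

lemma translate_sumset: "X + {g} + S = X + S + {g}" for X :: "'a::ab_group_add set"
  by (simp add: ac_simps)

lemma card_le_sumset: "finite X \<Longrightarrow> finite S \<Longrightarrow> s \<in> S \<Longrightarrow> card X \<le> card (X + S)"
  for X :: "'a::ab_group_add set"
  by (metis card_mono card_translate empty_subsetI finite_set_plus insert_subset set_plus_mono2 subset_refl)

lemma card_uminus_image: "card (uminus ` X) = card X" for X :: "'a::ab_group_add set"
  by (rule card_image) simp

lemma uminus_image_plus: "uminus ` (X + Y) = uminus ` X + uminus ` Y" for X Y :: "'a::ab_group_add set"
  by (force simp: set_plus_def)

section \<open>Atoms of the isoperimetric problem\<close>

text \<open>
The isoperimetric method of Hamidoune studies how little the cardinality of \<open>X\<close> can grow when a
fixed set \<open>S\<close> is added to it. Sets with fewer than two elements, and sets whose sum with \<open>S\<close> misses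
fewer than two elements of the ambient group \<open>K\<close>, are left out because their growth says nothing about
the structure of \<open>S\<close>. Among the other sets, an atom (a 2-atom in Hamidoune's terminology) minimises
\<open>card (X + S) - card X\<close>, and among the minimisers it has the least size. The inequalities are written
as sums since cardinalities are natural numbers.
\<close>

definition separable :: "'a::ab_group_add set \<Rightarrow> 'a set \<Rightarrow> 'a set \<Rightarrow> bool" where
  "separable K S X \<longleftrightarrow> X \<subseteq> K \<and> 2 \<le> card X \<and> card (X + S) + 2 \<le> card K"

definition atom :: "'a::ab_group_add set \<Rightarrow> 'a set \<Rightarrow> 'a set \<Rightarrow> bool" where
  "atom K S M \<longleftrightarrow> separable K S M \<and>
     (\<forall>X. separable K S X \<longrightarrow>
        card (M + S) + card X < card (X + S) + card M \<or>
        card (M + S) + card X = card (X + S) + card M \<and> card M \<le> card X)"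

lemma atom_exists:
  fixes K :: "'a::ab_group_add set"
  assumes K: "finite K" "S \<subseteq> K" "S \<noteq> {}" and X: "separable K S X"
  obtains M where "atom K S M" "card (M + S) + card X \<le> card (X + S) + card M"
proof -
  let ?e = "\<lambda>X. card (X + S) - card X"
  have le: "card Y \<le> card (Y + S)" if "separable K S Y" for Y
    using that K card_le_sumset[of Y S] by (auto simp: separable_def intro: finite_subset)
  obtain Y where Y: "separable K S Y" "\<And>Z. separable K S Z \<Longrightarrow> ?e Y \<le> ?e Z"
    using ex_has_least_nat[of "separable K S" X ?e] X by blast
  obtain M where M: "separable K S M \<and> ?e M = ?e Y"
    "\<And>Z. separable K S Z \<and> ?e Z = ?e Y \<Longrightarrow> card M \<le> card Z"
    using ex_has_least_nat[of "\<lambda>M. separable K S M \<and> ?e M = ?e Y" Y card] Y by blast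
  have *: "card (M + S) + card Z < card (Z + S) + card M \<or>
        card (M + S) + card Z = card (Z + S) + card M \<and> card M \<le> card Z"
    if Z: "separable K S Z" for Z
    using Y(2)[OF Z] M(1) M(2)[of Z] le[OF Z] le[of M] Z by linarith
  show ?thesis
    using that[of M] *[OF X] * M(1) unfolding atom_def by (metis less_imp_le order_refl)
qed

lemma atom_translate:
  fixes K :: "'a::ab_group_add set"
  assumes K: "subgrp K" and M: "atom K S M" and g: "g \<in> K"
  shows "atom K S (M + {g})"
    using M translate_subset[OF K _ g, of M] unfolding atom_def separable_def
    by (auto simp: translate_sumset)

text \<open>
The union and the intersection of two translates of an atom grow by at most as much as the atom
itself, because \<open>X \<mapsto> card (X + S)\<close> is submodular. An intersection with two or more elements would
therefore be an atom again, but smaller, provided that the union is separable. This last point comes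
from a duality: if \<open>M\<close> minimises the growth, so does \<open>- (K - (M + S))\<close>, so this set is at least as
large as \<open>M\<close>, and that leaves enough room for the union.
\<close>

lemma atom_inter:
  fixes K :: "'a::ab_group_add set"
  assumes K: "subgrp K" "finite K" "S \<subseteq> K" "S \<noteq> {}"
    and M: "atom K S M" and g: "g \<in> K"
  shows "M + {g} = M \<or> card (M \<inter> (M + {g})) \<le> 1"
proof (rule ccontr)
  assume "\<not> ?thesis"
  then have ne: "M + {g} \<noteq> M" and I: "2 \<le> card (M \<inter> (M + {g}))" by auto
  define N where "N = M + {g}"
  have sM: "separable K S M" using M by (simp add: atom_def)
  have N: "N \<subseteq> K" "card N = card M" "card (N + S) = card (M + S)"
    using sM K(1) g translate_subset[of K M g] unfolding N_def separable_def
    by (simp_all add: translate_sumset)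
  have fin: "finite X" if "X \<subseteq> K" for X using that K(2) finite_subset by blast
  have MK: "M \<subseteq> K" "M + S \<subseteq> K" "N + S \<subseteq> K"
    using sM sumset_subset K N unfolding separable_def by auto
  have key: "card (M + S) + card X \<le> card (X + S) + card M"
    if "separable K S X" for X using M that unfolding atom_def by fastforce
  have key2: "card M \<le> card X"
    if "separable K S X" "card (X + S) + card M \<le> card (M + S) + card X" for X
    using M that unfolding atom_def by fastforce
  have dual: "card M + card (M + S) \<le> card K"
  proof -
    define Y where "Y = uminus ` (K - (M + S))"
    have cY: "card Y = card K - card (M + S)"
      unfolding Y_def card_uminus_image using MK fin by (simp add: card_Diff_subset)
    have YK: "Y \<subseteq> K" unfolding Y_def using subgrp_uminus[OF K(1)] by auto
    have "uminus ` (Y + S) \<subseteq> K - M"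
    proof
      fix z assume "z \<in> uminus ` (Y + S)"
      then obtain w s where w: "w \<in> K - (M + S)" "s \<in> S" "z = w - s"
        unfolding Y_def by (auto elim!: set_plus_elim)
      have "z \<notin> M" using w by (metis DiffD2 diff_add_cancel set_plus_intro)
      then show "z \<in> K - M" using w K subgrp_diff by blast
    qed
    then have "card (Y + S) \<le> card (K - M)"
      using card_mono[of "K - M"] K(2) by (metis card_uminus_image finite_Diff)
    then have c: "card (Y + S) \<le> card K - card M"
      using MK fin by (simp add: card_Diff_subset)
    have "separable K S Y"
      using c cY YK sM card_mono[OF K(2) MK(1)] unfolding separable_def by linarith
    from key2[OF this] show ?thesis using c cY
      card_mono[OF K(2) MK(1)] card_mono[OF K(2) MK(2)] by linarith
  qed
  have "card ((M \<inter> N) + S) + card ((M \<union> N) + S) \<le> card ((M + S) \<inter> (N + S)) + card ((M + S) \<union> (N + S))"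
    by (intro add_mono card_mono) (auto simp: Un_set_plus MK fin elim!: set_plus_elim)
  also have "\<dots> = card (M + S) + card (N + S)"
    using card_Un_Int[of "M + S" "N + S"] MK fin by simp
  finally have sub: "card ((M \<inter> N) + S) + card ((M \<union> N) + S) \<le> 2 * card (M + S)"
    using N by simp
  have MN: "card (M \<inter> N) + card (M \<union> N) = 2 * card M"
    using card_Un_Int[of M N] MK N fin by simp
  have "card ((M \<inter> N) + S) \<le> card (M + S)"
    by (intro card_mono) (auto simp: MK fin elim!: set_plus_elim)
  then have sI: "separable K S (M \<inter> N)"
    using I sM unfolding separable_def N_def by auto
  have "card (M \<union> N) \<ge> card M" by (intro card_mono) (auto simp: MK N fin)
  then have sU: "separable K S (M \<union> N)"
    using key[OF sI] I sM MK N sub dual unfolding separable_def N_def[symmetric]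
    by auto
  have "card M \<le> card (M \<inter> N)"
    using key2[OF sI] key[OF sU] sub MN by linarith
  then have "M \<inter> N = M" "M \<inter> N = N"
    using card_seteq[of M "M \<inter> N"] card_seteq[of N "M \<inter> N"] N MK fin by auto
  then show False using ne N_def by simp
qed

text \<open>
For \<open>M \<subseteq> K\<close> this says that no nonzero element of \<open>K\<close> is a difference of two elements of \<open>M\<close> in two
ways, that is, \<open>M\<close> is a Sidon set.
\<close>

definition sidon :: "'a::ab_group_add set \<Rightarrow> 'a set \<Rightarrow> bool" where
  "sidon K M \<longleftrightarrow> (\<forall>g\<in>K. g \<noteq> 0 \<longrightarrow> card (M \<inter> (M + {g})) \<le> 1)"

text \<open>
If some nonzero \<open>g\<close> stabilises \<open>M\<close>, then for \<open>a \<in> M\<close> both \<open>a\<close> and \<open>a + g\<close> lie in \<open>M \<inter> (M + {a})\<close>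
(recall \<open>0 \<in> M\<close>). Two common elements force \<open>M + {a} = M\<close>, so \<open>M\<close> is stable under subtraction.
\<close>

lemma atom_subgrp_or_sidon:
  fixes K :: "'a::ab_group_add set"
  assumes K: "subgrp K" "finite K" "S \<subseteq> K" "S \<noteq> {}"
    and M: "atom K S M" "0 \<in> M"
  shows "subgrp M \<or> sidon K M"
proof (rule disjCI)
  assume "\<not> sidon K M"
  then obtain g where g: "g \<in> K" "g \<noteq> 0" "M + {g} = M"
    using atom_inter[OF K M(1)] unfolding sidon_def by blast
  have MK: "M \<subseteq> K" using M by (simp add: atom_def separable_def)
  have per: "M + {a} = M" if a: "a \<in> M" for a
  proof -
    have "a + g \<in> M" using a g(3) mem_translate[of "a + g" M g] by simp
    moreover have "a + g \<in> M + {a}" "a \<in> M + {a}"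
      using g(3) M(2) mem_translate[of g M g] by auto
    ultimately have "card {a, a + g} \<le> card (M \<inter> (M + {a}))"
      using a MK K(2) by (intro card_mono) (auto intro: finite_subset)
    then show ?thesis using atom_inter[OF K M(1), of a] a MK g(2) by auto
  qed
  show "subgrp M"
    unfolding subgrp_def
  proof (intro conjI ballI)
    fix x y assume "x \<in> M" "y \<in> M"
    then show "x - y \<in> M" using per[of y] mem_translate by metis
  qed (fact M(2))
qed

section \<open>Periodic sets and cosets\<close>

lemma mem_coset [simp]: "x \<in> {g} + H \<longleftrightarrow> x - g \<in> H" for x g :: "'a::ab_group_add"
  using mem_translate[of x H g] by (simp only: add.commute)

lemma card_coset [simp]: "card ({g} + H) = card H" for g :: "'a::ab_group_add"
  by (simp add: add.commute[of "{g}"])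

lemma subgrp_stabilizer: "subgrp {g. X + {g} = X}" for X :: "'a::ab_group_add set"
proof -
  have *: "X + {g} = X \<longleftrightarrow> (\<forall>z. z - g \<in> X \<longleftrightarrow> z \<in> X)" for g :: 'a
    by (auto simp: set_eq_iff)
  have "z - (g - h) \<in> X \<longleftrightarrow> z \<in> X"
    if "\<forall>z. z - g \<in> X \<longleftrightarrow> z \<in> X" "\<forall>z. z - h \<in> X \<longleftrightarrow> z \<in> X" for g h z :: 'a
  proof -
    have "z - (g - h) \<in> X \<longleftrightarrow> z - (g - h) - h \<in> X" using that(2) by blast
    also have "z - (g - h) - h = z - g" by simp
    finally show ?thesis using that(1) by blast
  qed
  then show ?thesis unfolding subgrp_def * by auto
qed

text \<open>
Each translation by an element of \<open>M\<close> maps the finite set \<open>X\<close> into itself, hence onto itself, and the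
elements that stabilise \<open>X\<close> form a subgroup.
\<close>

lemma periodic_hull:
  fixes X :: "'a::ab_group_add set"
  assumes "finite X" "X + M \<subseteq> X"
  shows "X + (subgrp hull M) \<subseteq> X"
proof -
  have "X + {m} = X" if "m \<in> M" for m
    using assms that by (intro card_seteq) (auto simp: set_plus_intro elim!: set_plus_elim)
  then have "subgrp hull M \<subseteq> {g. X + {g} = X}"
    by (intro hull_minimal subgrp_stabilizer) auto
  then show ?thesis by (force elim!: set_plus_elim)
qed

lemma card_coset_split:
  fixes S :: "'a::ab_group_add set"
  assumes "finite S" "finite M" "subgrp H" "M \<subseteq> H"
  shows "card (S + M) = card (S \<inter> ({y} + H) + M) + card ((S - ({y} + H)) + M)"
proof -
  have "S + M = (S \<inter> ({y} + H) + M) \<union> ((S - ({y} + H)) + M)"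
    by (simp add: Un_set_plus[symmetric] Int_Diff_Un)
  moreover have "(S \<inter> ({y} + H) + M) \<inter> ((S - ({y} + H)) + M) = {}"
  proof -
    have "m \<in> H" if "m \<in> M" for m using that assms by blast
    have 1: "z - y \<in> H" if z: "z \<in> S \<inter> ({y} + H) + M" for z
    proof -
      obtain u m where "z = u + m" "u - y \<in> H" "m \<in> M" using z by (auto elim!: set_plus_elim)
      then show ?thesis using subgrp_add[OF assms(3), of "u - y" m] assms(4)
        by (auto simp: algebra_simps)
    qed
    have 2: "z - y \<notin> H" if z: "z \<in> (S - ({y} + H)) + M" for z
    proof -
      obtain u m where "z = u + m" "u - y \<notin> H" "m \<in> M" using z by (auto elim!: set_plus_elim)
      then show ?thesis using subgrp_diff[OF assms(3), of "z - y" m] assms(4)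
        by (auto simp: algebra_simps)
    qed
    show ?thesis using 1 2 by blast
  qed
  ultimately show ?thesis
    using card_Un_disjoint[of "S \<inter> ({y} + H) + M" "(S - ({y} + H)) + M"] assms
    by (simp add: finite_set_plus)
qed

text \<open>
The sum \<open>S + M\<close> has fewer than \<open>card M\<close> elements beyond \<open>card S\<close>. If a single coset of \<open>H\<close> already
accounts for \<open>card M - 1\<close> of them, nothing is left for the other cosets: there \<open>S\<close> is stable under
adding \<open>M\<close> and thus a union of full cosets. Only the one coset can be filled incompletely.
\<close>

lemma near_periodic_of_coset_excess:
  fixes S :: "'a::ab_group_add set"
  assumes fin: "finite S" "finite M" "finite H" and M: "0 \<in> M" "H = subgrp hull M"
    and small: "card (S + M) < card S + card M" and y: "y \<in> S"
    and exc: "card (S \<inter> ({y} + H)) + card M \<le> card (S \<inter> ({y} + H) + M) + 1"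
  shows "card (S + H) < card S + card H"
proof -
  have H: "subgrp H" "M \<subseteq> H" unfolding M by (auto simp: subgrp_hull hull_inc)
  define S' where "S' = S - ({y} + H)"
  have cS: "card S = card (S \<inter> ({y} + H)) + card S'"
    unfolding S'_def using fin card_Int_Diff by blast
  have "card (S' + M) \<le> card S'"
    using small exc card_coset_split[OF fin(1,2) H, of y] cS unfolding S'_def by linarith
  moreover have "S' \<subseteq> S' + M" using M(1) set_zero_plus2[of M S'] by (simp add: add.commute)
  ultimately have "S' + M = S'"
    using card_seteq[of "S' + M" S'] fin S'_def by (simp add: finite_set_plus)
  then have per: "S' + H \<subseteq> S'"
    using periodic_hull[of S' M] fin unfolding S'_def M(2) by auto
  have "S + H \<subseteq> S' \<union> ({y} + H)"
  proof
    fix z assume "z \<in> S + H"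
    then obtain s h where z: "z = s + h" "s \<in> S" "h \<in> H" by (auto elim!: set_plus_elim)
    show "z \<in> S' \<union> ({y} + H)"
    proof (cases "s \<in> S'")
      case True
      then show ?thesis using z per by blast
    next
      case False
      then have "s - y \<in> H" using z unfolding S'_def by auto
      from subgrp_add[OF H(1) this z(3)] show ?thesis using z by (simp add: algebra_simps)
    qed
  qed
  then have "card (S + H) \<le> card (S' \<union> ({y} + H))"
    by (intro card_mono) (auto simp: S'_def fin finite_set_plus)
  also have "\<dots> \<le> card S' + card H" using card_Un_le[of S' "{y} + H"] by simp
  also have "card S' < card S"
  proof (rule psubset_card_mono)
    have "y \<notin> S'" using subgrp_zero[OF H(1)] unfolding S'_def by simp
    then show "S' \<subset> S" using y unfolding S'_def by blast
  qed (fact fin)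
  finally show ?thesis by simp
qed

section \<open>The critical pair theorem\<close>

text \<open>
The arithmetic progression with first term \<open>a\<close>, difference \<open>x\<close> and largest index \<open>c\<close>. Iterated
addition stands for the multiples of \<open>x\<close>, which a general commutative group does not provide as an
operation.
\<close>

definition ap :: "'a::ab_group_add \<Rightarrow> 'a \<Rightarrow> nat \<Rightarrow> 'a set" where
  "ap a x c = (\<lambda>i. ((+) x ^^ i) a) ` {..c}"

text \<open>
In a cyclic group, walking through \<open>S\<close> in steps of \<open>x\<close> one leaves \<open>S\<close> at only one place. Starting at
a point \<open>a\<close> whose predecessor is outside \<open>S\<close>, the walk traces a progression up to that exit. The
rest of \<open>S\<close> has no exit at all, so if it were nonempty it would be the whole group.
\<close>

lemma ap_of_few_exits:
  fixes S :: "'a::ab_group_add set"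
  assumes S: "finite S" "S \<subseteq> subgrp hull {0, x}" "S \<noteq> subgrp hull {0, x}" "S \<noteq> {}"
    and few: "card (S + {0, x}) \<le> card S + 1"
  shows "\<exists>a\<in>S. \<exists>c. S = ap a x c"
proof -
  define H where "H = subgrp hull {0, x}"
  have H: "subgrp H" "x \<in> H" unfolding H_def by (auto simp: subgrp_hull hull_inc)
  have full: "Y = H" if Y: "finite Y" "Y \<subseteq> H" "Y \<noteq> {}" "Y + {x} \<subseteq> Y" for Y
  proof -
    have "Y + {0, x} \<subseteq> Y" using Y(4) by (auto elim!: set_plus_elim)
    then have per: "Y + H \<subseteq> Y" unfolding H_def by (rule periodic_hull[OF Y(1)])
    obtain y where y: "y \<in> Y" using Y by auto
    have "h \<in> Y" if "h \<in> H" for h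
      using per set_plus_intro[OF y subgrp_diff[OF H(1) that, of y]] y Y(2) by auto
    then show ?thesis using Y by auto
  qed
  have "\<exists>a\<in>S. a - x \<notin> S"
  proof (rule ccontr)
    assume no: "\<not> ?thesis"
    have "S \<subseteq> S + {x}"
    proof
      fix z assume "z \<in> S"
      then have "z - x \<in> S" using no by blast
      then show "z \<in> S + {x}" by simp
    qed
    then have "S + {x} = S" using card_seteq[of "S + {x}" S] S by (simp add: finite_set_plus)
    then show False using full[of S] S unfolding H_def by auto
  qed
  then obtain a where a: "a \<in> S" "a - x \<notin> S" by blast
  define f where "f i = ((+) x ^^ i) a" for i
  have f0: "f 0 = a" and fSuc: "f (Suc i) = f i + x" for i
    by (simp_all add: f_def add.commute)
  have f_add: "f (i + j) - f i = f j - a" for i j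
    by (induction j) (simp_all add: f0 fSuc)
  have "\<exists>j. f j \<notin> S"
  proof (rule ccontr)
    assume all: "\<not> ?thesis"
    then have "\<not> inj f" using S(1) finite_imageD[of f UNIV] finite_subset[of "range f" S] by auto
    then obtain i j where ij: "i < j" "f i = f j" by (metis injI linorder_cases)
    then obtain p where "j = i + Suc p" using less_imp_Suc_add by auto
    then have "f (Suc p) = a" using f_add[of i "Suc p"] ij(2) by simp
    then have "f p = a - x" using fSuc[of p] by (simp add: algebra_simps)
    then show False using all a by metis
  qed
  then obtain j where j: "f j \<notin> S" "\<And>i. i < j \<Longrightarrow> f i \<in> S"
    using exists_least_iff[of "\<lambda>j. f j \<notin> S"] by auto
  have "j \<noteq> 0" using j a f0 by metis
  then obtain c where c: "j = Suc c" by (cases j) auto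
  define T where "T = ap a x c"
  have T: "T = f ` {..c}" unfolding T_def ap_def f_def ..
  have TS: "T \<subseteq> S" unfolding T using j c by auto
  have exit: "z = f c" if z: "z \<in> S" "z + x \<notin> S" for z
  proof (rule ccontr)
    assume ne: "z \<noteq> f c"
    have "S \<union> {z + x, f c + x} \<subseteq> S + {0, x}"
      using z j(2)[of c] c set_plus_Un[of S "{0}" "{x}"]
      by (auto simp: insert_commute[of x 0])
    then have "card (S \<union> {z + x, f c + x}) \<le> card (S + {0, x})"
      using S by (intro card_mono) (auto simp: finite_set_plus)
    moreover have "card (S \<union> {z + x, f c + x}) = card S + 2"
      using S(1) z j(1) c fSuc[of c] ne by (subst card_Un_disjoint) auto
    ultimately show False using few by simp
  qed
  have "S - T = {}"
  proof (rule ccontr)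
    assume ne: "S - T \<noteq> {}"
    have "z + x \<in> S - T" if z: "z \<in> S - T" for z
    proof
      show "z + x \<in> S" using exit[of z] z T by auto
      show "z + x \<notin> T"
      proof
        assume "z + x \<in> T"
        then obtain i where i: "z + x = f i" "i \<le> c" unfolding T by auto
        show False
        proof (cases i)
          case 0
          then have "z = a - x" using i f0 by (simp add: algebra_simps)
          then show False using a z by simp
        next
          case (Suc p)
          then have "z = f p" using i fSuc by simp
          then show False using z T i Suc by auto
        qed
      qed
    qed
    then have "(S - T) + {x} \<subseteq> S - T" by (auto elim!: set_plus_elim)
    then have "S - T = H" using full[of "S - T"] S ne unfolding H_def by auto
    moreover have "a \<in> H" "a \<in> T" using a S unfolding H_def T f0[symmetric] by auto
    ultimately show False by auto
  qed
  then show ?thesis using TS a(1) unfolding T_def by blast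
qed

lemma sidon_translates:
  assumes "sidon K M" "subgrp K" "a \<in> K" "b \<in> K" "a \<noteq> b"
  shows "card ((M + {a}) \<inter> (M + {b})) \<le> 1"
proof -
  have "(M + {a}) \<inter> (M + {b}) = (M \<inter> (M + {b - a})) + {a}" by (auto simp: algebra_simps)
  then show ?thesis using assms subgrp_diff[of K b a] unfolding sidon_def by simp
qed

text \<open>
Translates of a Sidon set overlap in at most one element, so already two or three of them cover
almost two or three times its size.
\<close>

lemma sidon_sumset2:
  fixes M :: "'a::ab_group_add set"
  assumes "sidon K M" "subgrp K" "finite K" "M \<subseteq> K" "T \<subseteq> K" "2 \<le> card T"
  shows "2 * card M \<le> card (T + M) + 1"
proof -
  obtain a b where ab: "a \<in> T" "b \<in> T" "a \<noteq> b"
    using assms(6) card_2_iff' by (metis card_le_Suc0_iff_eq assms(3,5) finite_subset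
        not_less_eq_eq numeral_2_eq_2)
  have fin: "finite M" "finite T" using assms finite_subset by auto
  have "card ((M + {a}) \<union> (M + {b})) \<le> card (T + M)"
    using ab fin by (intro card_mono) (auto simp: finite_set_plus add.commute[of M] elim!: set_plus_elim)
  then show ?thesis
    using card_Un_Int[of "M + {a}" "M + {b}"] sidon_translates[of K M a b] ab assms fin
    by (auto simp: finite_set_plus subset_iff)
qed

lemma sidon_sumset3:
  fixes M :: "'a::ab_group_add set"
  assumes "sidon K M" "subgrp K" "finite K" "M \<subseteq> K" "T \<subseteq> K" "3 \<le> card T"
  shows "3 * card M \<le> card (T + M) + 3"
proof -
  have fin: "finite M" "finite T" using assms finite_subset by auto
  obtain U where U: "U \<subseteq> T" "card U = 3" using assms(6) obtain_subset_with_card_n by metis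
  then obtain a b c where abc: "U = {a, b, c}" "a \<noteq> b" "b \<noteq> c" "a \<noteq> c"
    using card_3_iff by metis
  have m: "a \<in> K" "b \<in> K" "c \<in> K" using U abc assms by auto
  let ?t = "\<lambda>x. M + {x}"
  have "card (?t a \<union> ?t b \<union> ?t c) \<le> card (T + M)"
    using U abc fin by (intro card_mono) (auto simp: finite_set_plus add.commute[of M] elim!: set_plus_elim)
  moreover have "card (?t a \<union> ?t b) + card (?t a \<inter> ?t b) = 2 * card M"
    using card_Un_Int[of "?t a" "?t b"] fin by (simp add: finite_set_plus)
  moreover have "card (?t a \<union> ?t b \<union> ?t c) + card ((?t a \<union> ?t b) \<inter> ?t c) = card (?t a \<union> ?t b) + card M"
    using card_Un_Int[of "?t a \<union> ?t b" "?t c"] fin by (simp add: finite_set_plus)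
  moreover have "card ((?t a \<union> ?t b) \<inter> ?t c) \<le> card (?t a \<inter> ?t c) + card (?t b \<inter> ?t c)"
    by (metis Int_Un_distrib2 card_Un_le)
  ultimately show ?thesis
    using sidon_translates[OF assms(1,2) m(1,2)] sidon_translates[OF assms(1,2) m(1,3)]
      sidon_translates[OF assms(1,2) m(2,3)] abc by linarith
qed

lemma atom_with_zero:
  assumes "subgrp K" "finite K" "S \<subseteq> K" "S \<noteq> {}" "separable K S X" "card (X + S) < card X + card S"
  obtains M where "atom K S M" "0 \<in> M" "card (M + S) < card M + card S"
proof -
  obtain M where M: "atom K S M" "card (M + S) + card X \<le> card (X + S) + card M"
    using atom_exists[OF assms(2-5)] .
  have "card M \<ge> 2" "M \<subseteq> K" using M by (auto simp: atom_def separable_def)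
  then obtain m where m: "m \<in> M" by fastforce
  have "atom K S (M + {- m})"
    using atom_translate[OF assms(1) M(1), of "- m"] subgrp_uminus[OF assms(1)] m \<open>M \<subseteq> K\<close> by auto
  moreover have "0 \<in> M + {- m}" using m by simp
  moreover have "card (M + {- m} + S) < card (M + {- m}) + card S"
    using M(2) assms(6) by (simp add: translate_sumset)
  ultimately show ?thesis using that by blast
qed

text \<open>
A counterexample may be replaced by an atom \<open>A\<close> of \<open>M\<close> inside \<open>H\<close>. By \<open>sidon_sumset2\<close> the set \<open>M\<close>
is then no larger than \<open>A\<close>. If \<open>A\<close> is a subgroup, then \<open>A + M\<close> contains at least two of its cosets,
which is too much. If \<open>A\<close> is a Sidon set, three translates of \<open>A\<close> are too much as well. The bound
\<open>3 \<le> card M\<close> is sharp, since two-element sets \<open>M\<close> arise from arithmetic progressions. The ambient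
group has to be the one generated by \<open>M\<close>, since a subgroup \<open>A\<close> containing \<open>M\<close> would not grow at all.
\<close>

lemma sidon_sumset_in_hull:
  fixes M :: "'a::ab_group_add set"
  assumes K: "subgrp K" "finite K" "sidon K M" "M \<subseteq> K" and M: "0 \<in> M" "3 \<le> card M"
    and H: "H = subgrp hull M" and T: "separable H M T"
  shows "card T + card M \<le> card (T + M)"
proof (rule ccontr)
  assume small: "\<not> ?thesis"
  have Hs: "subgrp H" "M \<subseteq> H" "H \<subseteq> K"
    unfolding H using K by (simp_all add: subgrp_hull hull_subset hull_minimal)
  have finH: "finite H" using Hs K finite_subset by blast
  have Hmin: "H \<subseteq> Q" if "subgrp Q" "M \<subseteq> Q" for Q
    unfolding H using that by (intro hull_minimal)
  obtain A where A: "atom H M A" "0 \<in> A" "card (A + M) < card A + card M"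
    using atom_with_zero[OF Hs(1) finH Hs(2) _ T] small M by auto
  have sA: "A \<subseteq> H" "2 \<le> card A" "card (A + M) + 2 \<le> card H"
    using A(1) by (auto simp: atom_def separable_def)
  have fin: "finite A" "finite M" using sA Hs finH finite_subset by blast+
  have "2 * card M \<le> card (A + M) + 1"
    using sidon_sumset2[OF K(3,1,2,4)] sA Hs by auto
  then have MA: "card M \<le> card A" using A(3) by linarith
  from atom_subgrp_or_sidon[OF Hs(1) finH Hs(2) _ A(1,2)] M
  consider "subgrp A" | "sidon H A" by auto
  then show False
  proof cases
    case 1
    have "\<not> M \<subseteq> A"
    proof
      assume "M \<subseteq> A"
      then have "H \<subseteq> A" using Hmin 1 by blast
      then have "card H \<le> card A" using fin by (intro card_mono)
      then show False using card_le_sumset[OF fin M(1)] sA by linarith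
    qed
    then obtain m where m: "m \<in> M" "m \<notin> A" by auto
    have "A \<inter> (A + {m}) = {}"
    proof -
      have "z - m \<notin> A" if "z \<in> A" for z
        using subgrp_diff[OF 1 that, of "z - m"] m by auto
      then show ?thesis by auto
    qed
    then have "card (A \<union> (A + {m})) = 2 * card A"
      using fin by (subst card_Un_disjoint) (auto simp: finite_set_plus)
    moreover have "card (A \<union> (A + {m})) \<le> card (A + M)"
      using fin m M(1) set_zero_plus2[of M A]
      by (intro card_mono) (auto simp: finite_set_plus add.commute[of A] elim!: set_plus_elim)
    ultimately show False using A(3) MA by linarith
  next
    case 2
    have "3 * card A \<le> card (A + M) + 3"
      using sidon_sumset3[OF 2 Hs(1) finH sA(1) Hs(2) M(2)] by (simp add: add.commute)
    then show False using A(3) MA M(2) by linarith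
  qed
qed

text \<open>
This is a form of Hamidoune's critical pair theorem: a generating set \<open>S\<close> that makes some separable
set grow by less than \<open>card S\<close> is an arithmetic progression or almost a union of cosets of a
nontrivial subgroup. An atom \<open>M\<close> of \<open>S\<close> containing \<open>0\<close> tells the cases apart. If \<open>M\<close> is a subgroup,
it is the required one. If \<open>M = {0, x}\<close>, then \<open>S\<close> consists of full cosets of the group generated by
\<open>x\<close> and of one further progression in steps of \<open>x\<close>. Otherwise \<open>M\<close> is a Sidon set with at least
three elements. By \<open>sidon_sumset_in_hull\<close> each coset of the group \<open>H\<close> generated by \<open>M\<close>
contains at most one element of \<open>S\<close> or is almost filled by \<open>S + M\<close>, and in both cases \<open>S\<close> is almost a
union of cosets of \<open>H\<close>.
\<close>

theorem critical_pair:
  fixes K S X :: "'a::ab_group_add set"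
  assumes K: "subgrp K" "finite K" and S: "S \<subseteq> K" "0 \<in> S" "K \<subseteq> subgrp hull S"
    and X: "separable K S X" "card (X + S) < card X + card S"
  shows "(\<exists>a\<in>K. \<exists>x\<in>K. \<exists>c. S = ap a x c) \<or>
    (\<exists>H. subgrp H \<and> H \<subseteq> K \<and> 2 \<le> card H \<and> \<not> S \<subseteq> H \<and> card (S + H) < card S + card H)"
    (is "_ \<or> ?bad")
proof -
  have gen: "K \<subseteq> Q" if "subgrp Q" "S \<subseteq> Q" for Q
    using S(3) hull_minimal[of S Q subgrp] that by auto
  have finS: "finite S" using S K finite_subset by blast
  obtain M where M: "atom K S M" "0 \<in> M" "card (M + S) < card M + card S"
    using atom_with_zero[OF K S(1) _ X] S(2) by auto
  have sM: "M \<subseteq> K" "2 \<le> card M" "card (M + S) + 2 \<le> card K"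
    using M(1) by (auto simp: atom_def separable_def)
  have finM: "finite M" using sM K finite_subset by blast
  have SK: "card S + 2 \<le> card K"
    using card_le_sumset[OF finS finM M(2)] sM by (simp add: add.commute)
  define H where "H = subgrp hull M"
  have H: "subgrp H" "M \<subseteq> H" "H \<subseteq> K"
    unfolding H_def using K sM by (simp_all add: subgrp_hull hull_subset hull_minimal)
  have finH: "finite H" using H K finite_subset by blast
  have cH: "card M \<le> card H" using H finH by (intro card_mono)
  have MS: "card (S + M) < card S + card M" using M(3) by (simp add: add.commute)
  have bad: ?bad if "\<not> S \<subseteq> H" "card (S + H) < card S + card H"
    using that H cH sM by (intro exI[of _ H]) auto
  from atom_subgrp_or_sidon[OF K S(1) _ M(1,2)] S(2)
  consider "subgrp M" | "card M = 2" | "sidon K M" "3 \<le> card M" using sM(2) by fastforce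
  then show ?thesis
  proof cases
    case 1
    have "\<not> S \<subseteq> M"
    proof
      assume "S \<subseteq> M"
      then have "K \<subseteq> M" using gen 1 by blast
      then have "card K \<le> card M" using finM by (intro card_mono)
      then show False using card_le_sumset[OF finM finS S(2)] sM by linarith
    qed
    then show ?thesis using 1 sM MS by blast
  next
    case 2
    then obtain x where x: "M = {0, x}" "x \<noteq> 0" using M(2) by (metis card_2_iff doubleton_eq_iff insertE singletonD)
    have few: "card (S + {0, x}) \<le> card S + 1" using MS 2 x by simp
    show ?thesis
    proof (cases "S \<subseteq> H")
      case True
      then have "H = K" using gen H by blast
      then have "S \<noteq> H" using SK by auto
      then show ?thesis
        using ap_of_few_exits[OF finS _ _ _ few] True S(1,2) sM(1) unfolding H_def x by blast
    next
      case False
      have "card (S + H) < card S + card H"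
      proof (cases "S + M \<subseteq> S")
        case True
        then have "card (S + H) \<le> card S"
          using periodic_hull[OF finS True] finS unfolding H_def by (intro card_mono)
        then show ?thesis using cH sM by linarith
      next
        case False
        then obtain z where z: "z \<in> S + M" "z \<notin> S" by blast
        from z(1) obtain s m where "z = s + m" "s \<in> S" "m \<in> M" by (elim set_plus_elim)
        then have s: "s \<in> S" "s + x \<notin> S" using z(2) x(1) by auto
        let ?Y = "S \<inter> ({s} + H)"
        have "s \<in> ?Y" using s H subgrp_zero by auto
        then have "s + x \<in> ?Y + M" using x by (intro set_plus_intro) auto
        then have "insert (s + x) ?Y \<subseteq> ?Y + M"
          using set_zero_plus2[of M ?Y] M(2) x by (auto simp: add.commute[of ?Y])
        then have "card (insert (s + x) ?Y) \<le> card (?Y + M)"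
          using finS finM by (intro card_mono) (auto simp: finite_set_plus)
        then have "card ?Y + 1 \<le> card (?Y + M)" using s finS by simp
        then show ?thesis
          using near_periodic_of_coset_excess[OF finS finM finH M(2) H_def MS s(1)] 2 by simp
      qed
      then show ?thesis using bad False by blast
    qed
  next
    case 3
    \<comment> \<open>A part of \<open>S\<close> in one coset that violates this is, after translation, separable with respect to
      \<open>M\<close> in \<open>H\<close>, and it grows by less than \<open>card M\<close> because the rest of \<open>S\<close> does not shrink.\<close>
    have sub: "card (S \<inter> ({y} + H)) \<le> 1 \<or> card H \<le> card (S \<inter> ({y} + H) + M) + 1" for y
    proof (rule ccontr)
      assume no: "\<not> ?thesis"
      let ?Y = "S \<inter> ({y} + H)" and ?Z = "S - ({y} + H)"
      have "card S = card ?Y + card ?Z" using finS card_Int_Diff by blast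
      moreover have "card ?Z \<le> card (?Z + M)" using card_le_sumset[of ?Z M 0] finS finM M(2) by auto
      ultimately have lt: "card (?Y + M) < card ?Y + card M"
        using MS card_coset_split[OF finS finM H(1,2), of y] by linarith
      let ?T = "?Y + {- y}"
      have "separable H M ?T"
        using no unfolding separable_def by (auto simp: translate_sumset)
      from sidon_sumset_in_hull[OF K 3(1) sM(1) M(2) 3(2) H_def this] lt
      show False by (simp add: translate_sumset)
    qed
    have notin: "\<not> S \<subseteq> H"
    proof
      assume "S \<subseteq> H"
      then have HK: "H = K" using gen H by blast
      then have "S \<inter> ({0} + H) = S" using S by auto
      then have "card S \<le> 1" using sub[of 0] sM HK by (auto simp: add.commute)
      then have "S = {0}" using S(2) finS by (metis card_le_Suc0_iff_eq One_nat_def singletonI subsetI subset_antisym singletonD)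
      then have "K \<subseteq> {0}" using gen[of "{0}"] by (simp add: subgrp_def)
      then have "card K \<le> 1" using card_mono[of "{0}" K] by simp
      then show False using SK by simp
    qed
    have "card (S + H) < card S + card H"
    proof (cases "\<exists>y\<in>S. card (S \<inter> ({y} + H) + M) < card H")
      case True
      then obtain y where y: "y \<in> S" "card (S \<inter> ({y} + H) + M) < card H" by blast
      let ?Y = "S \<inter> ({y} + H)"
      have yY: "y \<in> ?Y" using y H subgrp_zero by auto
      have YM: "?Y + M \<subseteq> {y} + H"
      proof
        fix z assume "z \<in> ?Y + M"
        then obtain u m where "z = u + m" "u - y \<in> H" "m \<in> M" by (auto elim!: set_plus_elim)
        then show "z \<in> {y} + H" using subgrp_add[OF H(1), of "u - y" m] H(2)
          by (auto simp: algebra_simps)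
      qed
      have "card ?Y + card M \<le> card (?Y + M) + 1"
      proof (cases "card ?Y \<le> 1")
        case True
        have "card M \<le> card (?Y + M)"
          using card_le_sumset[OF finM _ yY] finS by (simp add: add.commute)
        then show ?thesis using True by linarith
      next
        case False
        then have c: "card (?Y + M) + 1 = card H" using sub[of y] y by linarith
        obtain z where z: "z \<in> {y} + H" "z \<notin> ?Y + M"
          using YM y(2) by (metis card_coset order_less_irrefl subsetI subset_antisym)
        \<comment> \<open>The coset has exactly one element \<open>z\<close> outside \<open>?Y + M\<close>, and then \<open>z - m\<close> is
          outside \<open>?Y\<close> for all \<open>m\<close> in \<open>M\<close>, which bounds the size of \<open>?Y\<close>.\<close>
        let ?N = "{z} + uminus ` M"
        have N: "\<exists>m\<in>M. w + m = z" if w: "w \<in> ?N" for w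
        proof -
          obtain m where "m \<in> M" "w - z = - m" using w by auto
          then show ?thesis by (intro bexI[of _ m]) (simp_all add: algebra_simps)
        qed
        have "?N \<inter> ?Y = {}"
        proof -
          have "w + m \<noteq> z" if "w \<in> ?Y" "m \<in> M" for w m using z(2) that by blast
          then show ?thesis using N by blast
        qed
        moreover have "?N \<subseteq> {y} + H"
        proof
          fix w assume "w \<in> ?N"
          then obtain m where "w + m = z" "m \<in> M" using N by blast
          then show "w \<in> {y} + H" using subgrp_diff[OF H(1), of "z - y" m] z(1) H(2)
            by (auto simp: algebra_simps)
        qed
        ultimately have "card (?N \<union> ?Y) = card ?N + card ?Y" "?N \<union> ?Y \<subseteq> {y} + H"
          using finM finS by (blast intro: card_Un_disjoint finite_set_plus)+
        moreover from this(2) have "card (?N \<union> ?Y) \<le> card ({y} + H)"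
          using finH by (intro card_mono) (simp add: finite_set_plus)
        ultimately have "card ?N + card ?Y \<le> card H" by simp
        then show ?thesis using c by (simp add: card_uminus_image)
      qed
      then show ?thesis
        using near_periodic_of_coset_excess[OF finS finM finH M(2) H_def MS y(1)] by simp
    next
      case False
      have "S + H \<subseteq> S + M"
      proof
        fix z assume "z \<in> S + H"
        then obtain s h where z: "z = s + h" "s \<in> S" "h \<in> H" by (auto elim!: set_plus_elim)
        let ?Y = "S \<inter> ({s} + H)"
        have "?Y + M \<subseteq> {s} + H"
        proof
          fix z assume "z \<in> ?Y + M"
          then obtain u m where "z = u + m" "u - s \<in> H" "m \<in> M" by (auto elim!: set_plus_elim)
          then show "z \<in> {s} + H" using subgrp_add[OF H(1), of "u - s" m] H(2)
            by (auto simp: algebra_simps)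
        qed
        moreover have "card ({s} + H) \<le> card (?Y + M)" using False z(2) by auto
        ultimately have "?Y + M = {s} + H"
          using finH by (intro card_seteq) (auto simp: finite_set_plus)
        then have "z \<in> ?Y + M" using z by auto
        then show "z \<in> S + M" by (auto elim!: set_plus_elim)
      qed
      then have "card (S + H) \<le> card (S + M)" using finS finM by (intro card_mono finite_set_plus)
      then show ?thesis using MS cH by linarith
    qed
    then show ?thesis using bad notin by blast
  qed
qed

section \<open>Almost periodic sets have periodic difference sets\<close>

text \<open>
This is the pigeonhole principle inside one coset: the two parts of \<open>S\<close>, moved into \<open>H\<close>, together
have more elements than \<open>H\<close>, so they meet whatever the shift \<open>h\<close> is.
\<close>

lemma coset_pair_fill:
  fixes S :: "'a::ab_group_add set"
  assumes H: "subgrp H" "finite H" and h: "h \<in> H"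
    and big: "card H < card (S \<inter> ({y} + H)) + card (S \<inter> ({z} + H))"
  shows "\<exists>y'\<in>S. \<exists>z'\<in>S. y' - z' = y - z + h"
proof -
  let ?U = "S \<inter> ({y} + H) + {- y}" and ?V = "S \<inter> ({z} + H) + {h - z}"
  have sub: "?U \<subseteq> H" "?V \<subseteq> H"
  proof -
    show "?U \<subseteq> H" by auto
    have "w \<in> H" if "w - (h - z) - z \<in> H" for w
      using subgrp_add[OF H(1) that h] by simp
    then show "?V \<subseteq> H" by auto
  qed
  have "?U \<inter> ?V \<noteq> {}"
  proof
    assume "?U \<inter> ?V = {}"
    then have "card (?U \<union> ?V) = card ?U + card ?V"
      using sub H(2) by (intro card_Un_disjoint) (auto intro: finite_subset)
    moreover have "card (?U \<union> ?V) \<le> card H" using sub H(2) by (intro card_mono) auto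
    ultimately show False using big by simp
  qed
  then obtain w where "w + y \<in> S" "w - (h - z) \<in> S" by auto
  then show ?thesis by (intro bexI[of _ "w + y"] bexI[of _ "w - (h - z)"]) (auto simp: algebra_simps)
qed

text \<open>
Altogether \<open>S\<close> misses fewer than \<open>card H\<close> elements of the cosets of \<open>H\<close> that it meets, so two distinct
cosets together miss fewer than \<open>card H\<close>.
\<close>

lemma coset_pair_big:
  fixes S :: "'a::ab_group_add set"
  assumes H: "subgrp H" "finite H" and S: "finite S" "card (S + H) < card S + card H"
    and yz: "y \<in> S" "z \<in> S" "y - z \<notin> H"
  shows "card H < card (S \<inter> ({y} + H)) + card (S \<inter> ({z} + H))"
proof -
  let ?C = "({y} + H) \<union> ({z} + H)"
  have "({y} + H) \<inter> ({z} + H) = {}"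
  proof -
    have False if "w - y \<in> H" "w - z \<in> H" for w
      using subgrp_diff[OF H(1) that(2,1)] yz(3) by simp
    then show ?thesis by auto
  qed
  then have C: "card ?C = 2 * card H" using H(2) by (subst card_Un_disjoint) (auto simp: finite_set_plus)
  have CS: "?C \<subseteq> S + H" using set_plus_mono2[of "{y}" S H H] set_plus_mono2[of "{z}" S H H] yz by auto
  have "card (S - ?C) \<le> card ((S + H) - ?C)"
    using S H set_zero_plus2[of H S] subgrp_zero[OF H(1)]
    by (intro card_mono) (auto simp: finite_set_plus add.commute[of S])
  also have "\<dots> = card (S + H) - card ?C"
    using CS S H by (intro card_Diff_subset) (auto simp: finite_set_plus)
  finally have 1: "card (S - ?C) + 2 * card H \<le> card (S + H)"
    using C card_mono[OF finite_set_plus[OF S(1) H(2)] CS] by linarith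
  have "card S = card (S \<inter> ?C) + card (S - ?C)" using S(1) card_Int_Diff by blast
  moreover have "card (S \<inter> ?C) \<le> card (S \<inter> ({y} + H)) + card (S \<inter> ({z} + H))"
    by (metis Int_Un_distrib card_Un_le)
  ultimately show ?thesis using 1 S(2) by linarith
qed

text \<open>
Two elements of different cosets can be moved within their cosets so that their difference changes by
any \<open>h \<in> H\<close>. Two elements of the same coset have a difference in \<open>H\<close>, and every element of \<open>H\<close> is
a difference of two elements of \<open>S\<close> in a coset that \<open>S\<close> fills by more than half. Such a coset exists
because \<open>S\<close> meets two cosets.
\<close>

lemma difference_set_periodic:
  fixes S :: "'a::ab_group_add set"
  assumes H: "subgrp H" "finite H" and S: "finite S" "card (S + H) < card S + card H"
    and ne: "p \<in> S" "q \<in> S" "p - q \<notin> H"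
    and yz: "y \<in> S" "z \<in> S" and h: "h \<in> H"
  shows "\<exists>y'\<in>S. \<exists>z'\<in>S. y' - z' = y - z + h"
proof (cases "y - z \<in> H")
  case False
  then show ?thesis using coset_pair_fill[OF H h] coset_pair_big[OF H S yz] by blast
next
  case True
  obtain t where t: "card H < card (S \<inter> ({t} + H)) + card (S \<inter> ({t} + H))"
  proof (cases "card (S \<inter> ({q} + H)) \<le> card (S \<inter> ({p} + H))")
    case True
    then show ?thesis using coset_pair_big[OF H S ne] that[of p] by linarith
  next
    case False
    then show ?thesis using coset_pair_big[OF H S ne] that[of q] by linarith
  qed
  have "y - z + h \<in> H" using subgrp_add[OF H(1) True h] .
  from coset_pair_fill[OF H this t] show ?thesis by simp
qed

section \<open>Sum-free sets in a finite subgroup\<close>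

abbreviation nfold :: "nat \<Rightarrow> 'a::comm_monoid_add set \<Rightarrow> 'a set" where
  "nfold h A \<equiv> (\<Sum>_<h. A)"

lemma nfold_translate:
  "nfold h (S + {a}) = nfold h S + {\<Sum>i<h. a}" for a :: "'a::ab_group_add"
proof -
  have "nfold h {a} = {\<Sum>i<h. a}"
    by (induction h) (simp_all add: set_zero set_plus_def)
  then show ?thesis by (simp only: sum.distrib)
qed

lemma nfold_uminus: "nfold h (uminus ` S) = uminus ` nfold h S" for S :: "'a::ab_group_add set"
  by (induction h) (simp_all add: uminus_image_plus set_zero)

lemma nfold_subset: "subgrp K \<Longrightarrow> S \<subseteq> K \<Longrightarrow> nfold h S \<subseteq> K"
  by (induction h) (simp_all add: sumset_subset set_zero subgrp_zero)

text \<open>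
If every separable set grows by at least \<open>card S\<close> when \<open>S\<close> is added, it does so as well when \<open>- S\<close> is
added, because negation turns one sum into the other. Hence every further summand contributes fully,
as long as the sum does not come close to the whole group.
\<close>

lemma nfold_differences_grow:
  fixes S :: "'a::ab_group_add set"
  assumes K: "subgrp K" "finite K" "S \<subseteq> K" "2 \<le> card S"
    and grow: "\<And>X. separable K S X \<Longrightarrow> card X + card S \<le> card (X + S)"
    and j: "1 \<le> j" and small: "card (nfold j S + nfold i (uminus ` S)) + 2 \<le> card K"
  shows "(j + i) * card S \<le> card (nfold j S + nfold i (uminus ` S))"
proof -
  let ?N = "uminus ` S"
  have N: "?N \<subseteq> K" using K subgrp_uminus by auto
  obtain s where s: "s \<in> S" using K(4) by fastforce
  have fin: "finite X" if "X \<subseteq> K" for X using that K finite_subset by blast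
  have growN: "card X + card S \<le> card (X + ?N)" if "separable K ?N X" for X
  proof -
    have eq: "card (uminus ` X + S) = card (X + ?N)"
      by (metis (no_types) card_uminus_image uminus_image_plus image_image image_cong minus_minus image_ident)
    have "separable K S (uminus ` X)"
      using that K subgrp_uminus unfolding separable_def eq card_uminus_image by blast
    from grow[OF this] show ?thesis by (simp add: eq card_uminus_image)
  qed
  have add_summand: "m + card S \<le> card (X + T)"
    if "T = S \<or> T = ?N" "X \<subseteq> K" "card (X + T) + 2 \<le> card K" "2 \<le> m"
      "card X + 2 \<le> card K \<Longrightarrow> m \<le> card X" for X T m
  proof -
    have T: "T \<subseteq> K" "\<exists>t. t \<in> T" using that(1) K N s by auto
    then have "card X \<le> card (X + T)" using card_le_sumset[of X T] fin that(2) by blast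
    then have "m \<le> card X" "separable K T X" using that T unfolding separable_def by auto
    then show ?thesis using that(1) grow growN by fastforce
  qed
  have jS: "card (nfold j S) + 2 \<le> card K \<Longrightarrow> j * card S \<le> card (nfold j S)"
    using j
  proof (induction j rule: dec_induct)
    case base
    then show ?case by simp
  next
    case (step j)
    have "2 \<le> j * card S" using mult_le_mono[OF step(1) K(4)] by simp
    then have "j * card S + card S \<le> card (nfold j S + S)"
      using add_summand[of S "nfold j S" "j * card S"] nfold_subset[OF K(1,3)] step by simp
    then show ?case by (simp add: add.commute)
  qed
  show ?thesis
    using small
  proof (induction i)
    case 0
    then show ?case using jS by simp
  next
    case (Suc i)
    let ?X = "nfold j S + nfold i ?N"
    have eq: "nfold j S + nfold (Suc i) ?N = ?X + ?N" by (simp add: add.assoc)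
    have "2 \<le> (j + i) * card S" using mult_le_mono[of 1 "j + i" 2 "card S"] j K(4) by simp
    moreover have "?X \<subseteq> K" by (intro sumset_subset nfold_subset K(1,3) N)
    ultimately have "(j + i) * card S + card S \<le> card (?X + ?N)"
      using add_summand[of ?N ?X "(j + i) * card S"] Suc unfolding eq by simp
    then show ?case unfolding eq by (simp add: algebra_simps)
  qed
qed

text \<open>
Let \<open>S\<close> be a translate of \<open>A\<close> through \<open>0\<close> and \<open>K\<close> the group it generates. Sum-freeness says that the
set of sums of \<open>k\<close> elements minus \<open>l - 1\<close> elements of \<open>S\<close>, suitably shifted, is disjoint from \<open>S\<close>.
If the shift does not lie in \<open>K\<close>, then all of \<open>A + K\<close> is sum-free. Otherwise that set has at most
\<open>card K - card S\<close> elements, and if each of its \<open>k + l - 1\<close> summands contributes \<open>card S\<close>, this is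
the bound \<open>(k + l) * card A \<le> card G\<close>. If not, \<open>critical_pair\<close> applies. When it yields a
subgroup \<open>H\<close>, the difference set of \<open>S\<close> is \<open>H\<close>-periodic by \<open>difference_set_periodic\<close>; since
\<open>k\<close> and \<open>l\<close> are positive, a difference of two elements of \<open>S\<close> is a summand of every sum of \<open>k\<close> elements
minus \<open>l\<close> elements, and these avoid not only the forbidden value but its whole coset of \<open>H\<close>.
\<close>

theorem sum_free_trichotomy:
  fixes A :: "'a::ab_group_add set"
  assumes G: "subgrp G" "finite G" and A: "A \<subseteq> G" "A \<noteq> {}"
    and kl: "0 < k" "0 < l" and free: "nfold k A \<inter> nfold l A = {}"
  shows "(\<exists>a\<in>G. \<exists>x\<in>G. \<exists>c. A = ap a x c) \<or> (k + l) * card A \<le> card G \<or>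
    (\<exists>H. subgrp H \<and> H \<subseteq> G \<and> 2 \<le> card H \<and> (nfold k A + H) \<inter> nfold l A = {})"
    (is "?ap \<or> ?small \<or> ?periodic")
proof -
  have finA: "finite A" using A G finite_subset by blast
  obtain a where a: "a \<in> A" using A by auto
  define S where "S = A + {- a}"
  define K where "K = subgrp hull S"
  have AS: "A = S + {a}" by (simp add: S_def set_eq_iff)
  have S0: "0 \<in> S" and cS: "card S = card A" using a unfolding S_def by simp_all
  have SG: "S \<subseteq> G"
    using translate_subset[OF G(1) A(1), of "- a"] subgrp_uminus[OF G(1), of a] a A(1) unfolding S_def by blast
  have K: "subgrp K" "S \<subseteq> K" "K \<subseteq> G"
    unfolding K_def using G SG by (simp_all add: subgrp_hull hull_subset hull_minimal)
  have finK: "finite K" and finS: "finite S" using K G SG finite_subset by blast+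
  define v where "v h = (\<Sum>i<h. a)" for h :: nat
  have nA: "nfold h A = nfold h S + {v h}" for h unfolding AS v_def by (rule nfold_translate)
  have per: ?periodic
    if H: "subgrp H" "H \<subseteq> G" "2 \<le> card H"
      and no: "\<And>u w h. u \<in> nfold k S \<Longrightarrow> w \<in> nfold l S \<Longrightarrow> h \<in> H \<Longrightarrow> u + v k + h \<noteq> w + v l" for H
  proof (intro exI[of _ H] conjI H)
    show "(nfold k A + H) \<inter> nfold l A = {}"
    proof (rule ccontr)
      assume "(nfold k A + H) \<inter> nfold l A \<noteq> {}"
      then obtain p h q where p: "p \<in> nfold k A" "h \<in> H" "q \<in> nfold l A" "p + h = q"
        by (auto elim!: set_plus_elim)
      then have "p - v k \<in> nfold k S" "q - v l \<in> nfold l S" unfolding nA by simp_all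
      from no[OF this p(2)] p(4) show False by simp
    qed
  qed
  have free': "u + v k \<noteq> w + v l" if "u \<in> nfold k S" "w \<in> nfold l S" for u w
    using free that unfolding nA by (metis IntI empty_iff set_plus_intro singletonI)
  consider "card A = 1" | "2 \<le> card A" using finA A by (metis One_nat_def Suc_leI card_gt_0_iff le_neq_implies_less numeral_2_eq_2)
  then show ?thesis
  proof cases
    case 1
    then have "A = ap a 0 0" using a by (auto simp: ap_def card_1_singleton_iff)
    then show ?thesis using a A(1) subgrp_zero[OF G(1)] by blast
  next
    case 2
    have cK: "2 \<le> card K" using 2 cS card_mono[OF finK K(2)] by simp
    show ?thesis
    proof (cases "v k - v l \<in> K")
      case False
      have "u + v k + h \<noteq> w + v l"
        if "u \<in> nfold k S" "w \<in> nfold l S" "h \<in> K" for u w h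
      proof
        assume eq: "u + v k + h = w + v l"
        have "u \<in> K" "w \<in> K"
          using that nfold_subset[OF K(1,2), of k] nfold_subset[OF K(1,2), of l] by auto
        then have "w - u - h \<in> K" using that subgrp_diff[OF K(1)] by blast
        moreover have "v k - v l = w - u - h" using eq by (simp add: algebra_simps)
        ultimately show False using False by simp
      qed
      from per[OF K(1,3) cK this] show ?thesis by blast
    next
      case w: True
      show ?thesis
      proof (cases "\<exists>X. separable K S X \<and> card (X + S) < card X + card S")
        case True
        then obtain X where X: "separable K S X" "card (X + S) < card X + card S" by blast
        have "K \<subseteq> subgrp hull S" unfolding K_def ..
        note critical_pair[OF K(1) finK K(2) S0 this X]
        then consider b x c where "b \<in> K" "x \<in> K" "S = ap b x c"
          | H where "subgrp H" "H \<subseteq> K" "2 \<le> card H" "\<not> S \<subseteq> H" "card (S + H) < card S + card H"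
          by blast
        then show ?thesis
        proof cases
          case 1
          have "((+) x ^^ i) (b + a) = ((+) x ^^ i) b + a" for i
            by (induction i) (simp_all add: add.assoc)
          then have "A = ap (b + a) x c" unfolding AS 1(3) ap_def
            by (auto simp: set_plus_def)
          then show ?thesis using 1 K a A subgrp_add[OF G(1)] by blast
        next
          case 2
          have finH: "finite H" using 2 finK finite_subset by blast
          obtain p where p: "p \<in> S" "p - 0 \<notin> H" using 2(4) by auto
          have "u + v k + h \<noteq> w + v l"
            if uwh: "u \<in> nfold k S" "w \<in> nfold l S" "h \<in> H" for u w h
          proof
            assume eq: "u + v k + h = w + v l"
            \<comment> \<open>One summand on each side is split off; the pair absorbs \<open>h\<close>.\<close>
            obtain k' l' where k': "k = Suc k'" "l = Suc l'" using kl by (metis Suc_pred')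
            obtain u' y where u': "u = u' + y" "u' \<in> nfold k' S" "y \<in> S"
              using uwh(1) unfolding k' sum.lessThan_Suc by (elim set_plus_elim)
            obtain w' z where w': "w = w' + z" "w' \<in> nfold l' S" "z \<in> S"
              using uwh(2) unfolding k' sum.lessThan_Suc by (elim set_plus_elim)
            obtain y' z' where y': "y' \<in> S" "z' \<in> S" "y' - z' = y - z + h"
              using difference_set_periodic[OF 2(1) finH finS 2(5) p(1) S0 p(2) u'(3) w'(3) uwh(3)] by blast
            have "u' + y' \<in> nfold k S" "w' + z' \<in> nfold l S"
              using u' w' y' unfolding k' sum.lessThan_Suc by auto
            from free'[OF this] have "u' + y' + v k \<noteq> w' + z' + v l" .
            moreover have "y' = z' + (y - z + h)" using y'(3) by (simp add: algebra_simps)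
            ultimately show False using eq u' w' by (simp add: algebra_simps)
          qed
          from per[OF 2(1) _ 2(3) this] 2(2) K(3) show ?thesis by blast
        qed
      next
        case False
        obtain l' where l': "l = Suc l'" using kl by (metis Suc_pred')
        let ?P = "nfold k S + nfold l' (uminus ` S)"
        have PK: "?P \<subseteq> K"
          using K(2) subgrp_uminus[OF K(1)] by (intro sumset_subset nfold_subset K(1,2)) blast
        have "(?P + {v k - v l}) \<inter> S = {}"
        proof (rule ccontr)
          assume "(?P + {v k - v l}) \<inter> S \<noteq> {}"
          then obtain s where s: "s \<in> S" "s - (v k - v l) \<in> ?P" by auto
          then obtain u t where ut: "u \<in> nfold k S" "t \<in> nfold l' S" "s - (v k - v l) = u - t"
            unfolding nfold_uminus by (auto elim!: set_plus_elim)
          have "t + s \<in> nfold l S" using ut s unfolding l' sum.lessThan_Suc by auto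
          from free'[OF ut(1) this] show False using ut(3) by (simp add: algebra_simps)
        qed
        moreover have "(?P + {v k - v l}) \<union> S \<subseteq> K"
          using translate_subset[OF K(1) PK w] K(2) by blast
        ultimately have "card (?P + {v k - v l}) + card S \<le> card K"
          using finK by (metis card_Un_disjoint card_mono finite_Un finite_subset)
        then have P: "card ?P + card S \<le> card K" by simp
        have "(k + l') * card S \<le> card ?P"
          using nfold_differences_grow[OF K(1) finK K(2), of k l'] False P 2 cS kl by force
        then have "(k + l) * card A \<le> card K" using P cS l' by (simp add: algebra_simps)
        then show ?thesis using card_mono[OF G(2) K(3)] by linarith
      qed
    qed
  qed
qed

section \<open>The group of rationals modulo one\<close>

text \<open>
The group \<open>\<rat>/\<int>\<close> contains a cyclic group of every finite order. It is a single type, independent of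
the order \<open>n\<close>, to which the results on finite subgroups of type class groups can be applied.
\<close>

quotient_type circle = rat / "\<lambda>x y. x - y \<in> \<int>"
proof (rule equivpI)
  show "reflp (\<lambda>x y::rat. x - y \<in> \<int>)" by (rule reflpI) simp
  show "symp (\<lambda>x y::rat. x - y \<in> \<int>)" by (rule sympI) (metis Ints_minus minus_diff_eq)
  show "transp (\<lambda>x y::rat. x - y \<in> \<int>)"
  proof (rule transpI)
    fix x y z :: rat assume "x - y \<in> \<int>" "y - z \<in> \<int>"
    from Ints_add[OF this] show "x - z \<in> \<int>" by simp
  qed
qed

instantiation circle :: ab_group_add
begin

lift_definition zero_circle :: circle is 0 .

lift_definition plus_circle :: "circle \<Rightarrow> circle \<Rightarrow> circle" is "(+)"
proof -
  fix a b c d :: rat assume "a - b \<in> \<int>" "c - d \<in> \<int>"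
  from Ints_add[OF this] show "a + c - (b + d) \<in> \<int>" by (simp add: algebra_simps)
qed

lift_definition uminus_circle :: "circle \<Rightarrow> circle" is uminus
  by (metis Ints_minus minus_diff_minus)

definition minus_circle :: "circle \<Rightarrow> circle \<Rightarrow> circle" where
  "minus_circle x y = x + - y"

instance
  by standard (transfer; simp add: minus_circle_def)+

end

lift_definition circle_frac :: "nat \<Rightarrow> int \<Rightarrow> circle" is "\<lambda>n i. of_int i / of_nat n" .

lemma circle_frac_add: "circle_frac n (i + j) = circle_frac n i + circle_frac n j"
  by transfer (simp add: add_divide_distrib)

lemma circle_frac_eq_0: "0 < n \<Longrightarrow> circle_frac n i = 0 \<longleftrightarrow> int n dvd i"
proof transfer
  fix n :: nat and i :: int assume n: "0 < n"
  show "(of_int i / of_nat n - 0 :: rat) \<in> \<int> \<longleftrightarrow> int n dvd i"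
  proof
    assume "(of_int i / of_nat n - 0 :: rat) \<in> \<int>"
    then obtain z where "of_int i / of_nat n = (of_int z :: rat)" by (auto elim: Ints_cases)
    then have "(of_int i :: rat) = of_int (z * int n)" using n by (simp add: field_simps)
    then show "int n dvd i" by (simp only: of_int_eq_iff) simp
  next
    assume "int n dvd i"
    then obtain z where "i = int n * z" by (elim dvdE)
    then show "(of_int i / of_nat n - 0 :: rat) \<in> \<int>" using n by simp
  qed
qed

section \<open>Sum-free sets modulo n as sets of integers\<close>

lemma nfold_image_hom:
  fixes \<phi> :: "'a::comm_monoid_add \<Rightarrow> 'b::comm_monoid_add"
  assumes "\<phi> 0 = 0" "\<And>x y. \<phi> (x + y) = \<phi> x + \<phi> y"
  shows "nfold h (\<phi> ` A) = \<phi> ` nfold h A"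
proof (induction h)
  case 0
  then show ?case by (simp add: set_zero assms)
next
  case (Suc h)
  have "\<phi> ` X + \<phi> ` Y = \<phi> ` (X + Y)" for X Y
    by (force simp: set_plus_def assms(2))
  then show ?case using Suc by simp
qed

text \<open>
Reducing the elements of a set modulo \<open>m\<close>, or choosing other representatives, changes its sums only
by multiples of \<open>m\<close>.
\<close>

lemma nfold_cong_mod:
  fixes m :: int
  assumes "x \<in> nfold h A" "\<And>a. a \<in> A \<Longrightarrow> \<exists>b\<in>B. m dvd a - b"
  shows "\<exists>y\<in>nfold h B. m dvd x - y"
  using assms(1)
proof (induction h arbitrary: x)
  case 0
  then show ?case by (auto simp: set_zero)
next
  case (Suc h)
  then obtain a u where u: "x = u + a" "u \<in> nfold h A" "a \<in> A"
    unfolding sum.lessThan_Suc by (elim set_plus_elim)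
  obtain y where y: "y \<in> nfold h B" "m dvd u - y" using Suc.IH[OF u(2)] by blast
  obtain b where b: "b \<in> B" "m dvd a - b" using assms(2) u(3) by blast
  have "m dvd x - (y + b)" using dvd_add[OF y(2) b(2)] u(1) by (simp add: algebra_simps)
  then show ?case using y b unfolding sum.lessThan_Suc by blast
qed

lemma nfold_interval_bounds:
  "x \<in> nfold h {a..b} \<Longrightarrow> int h * a \<le> x \<and> x \<le> int h * b" for a b :: int
proof (induction h arbitrary: x)
  case 0
  then show ?case by (auto simp: set_zero)
next
  case (Suc h)
  then obtain c u where "x = u + c" "u \<in> nfold h {a..b}" "c \<in> {a..b}"
    unfolding sum.lessThan_Suc by (elim set_plus_elim)
  then show ?case using Suc.IH[of u] by (auto simp: algebra_simps)
qed

lemma fold_sumset_integer_mod_group: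
  assumes n: "0 < n" and A: "A \<subseteq> {0..<int n}"
  shows "fold_sumset (integer_mod_group n) h A = (\<lambda>x. x mod int n) ` nfold h A"
proof -
  interpret comm_group "integer_mod_group n" by simp
  have fp: "finprod (integer_mod_group n) f {..<h} = (\<Sum>i<h. f i) mod int n"
    if "f \<in> {..<h} \<rightarrow> A" for f
    using that
  proof (induction h)
    case 0
    then show ?case by simp
  next
    case (Suc h)
    have "f i \<in> carrier (integer_mod_group n)" if "i \<le> h" for i
    proof -
      have "f i \<in> A" using Suc.prems that by auto
      then show ?thesis using A n by (auto simp: carrier_integer_mod_group)
    qed
    then have "f \<in> {..<h} \<rightarrow> carrier (integer_mod_group n)" "f h \<in> carrier (integer_mod_group n)"
      by auto
    then have "finprod (integer_mod_group n) f {..<Suc h} = (f h + (\<Sum>i<h. f i) mod int n) mod int n"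
      unfolding lessThan_Suc using Suc.IH Suc.prems by (subst finprod_insert) (auto simp: Pi_iff)
    then show ?case by (simp add: mod_simps add.commute)
  qed
  have "fold_sumset (integer_mod_group n) h A = {(\<Sum>i<h. f i) mod int n | f. f \<in> {..<h} \<rightarrow> A}"
    unfolding fold_sumset_def using fp by (intro Collect_cong) (metis (no_types, lifting))
  also have "\<dots> = (\<lambda>x. x mod int n) ` nfold h A"
    by (auto simp: set_sum_alt Pi_def image_def)
  finally show ?thesis .
qed

lemma kl_sum_free_integer_mod_group:
  assumes n: "0 < n"
  shows "kl_sum_free (integer_mod_group n) k l A \<longleftrightarrow>
    A \<subseteq> {0..<int n} \<and> (\<forall>x\<in>nfold k A. \<forall>y\<in>nfold l A. \<not> int n dvd x - y)"
proof (cases "A \<subseteq> {0..<int n}")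
  case True
  then show ?thesis
    unfolding kl_sum_free_def fold_sumset_integer_mod_group[OF n True]
    using n by (auto simp: carrier_integer_mod_group mod_eq_dvd_iff)
next
  case False
  then show ?thesis using n by (auto simp: kl_sum_free_def carrier_integer_mod_group)
qed

lemma arith_prog_integer_mod_group:
  assumes n: "0 < n"
  shows "arith_prog (integer_mod_group n) ((\<lambda>i. (p + int i * q) mod int n) ` {..c})"
  unfolding arith_prog_def
proof (rule bexI[of _ "p mod int n"], rule bexI[of _ "q mod int n"], rule exI[of _ c])
  show "p mod int n \<in> carrier (integer_mod_group n)" "q mod int n \<in> carrier (integer_mod_group n)"
    using n by (simp_all add: carrier_integer_mod_group)
  show "(\<lambda>i. (p + int i * q) mod int n) ` {..c} =
    {p mod int n \<otimes>\<^bsub>integer_mod_group n\<^esub> (q mod int n) [^]\<^bsub>integer_mod_group n\<^esub> i | i. i \<le> c}"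
    by (auto simp: mod_simps image_def)
qed

section \<open>Lower and upper bounds by progressions\<close>

text \<open>
The interval from \<open>a\<close> to \<open>a + m - 1\<close> is sum-free if no sum of \<open>k\<close> elements minus a sum of \<open>l\<close>
elements is a multiple of \<open>n\<close>. These differences fill an interval of length \<open>(k + l) (m - 1)\<close>, which
can be moved in steps of \<open>k - l\<close> by changing \<open>a\<close>. It suffices to fit it strictly between \<open>0\<close> and
\<open>n\<close>, and the slack \<open>k + l - 1\<close> left by the hypothesis is at least one step.
\<close>

lemma interval_progression:
  assumes kl: "0 < k" "0 < l" "k \<noteq> l" and m: "0 < m" "(k + l) * m \<le> n"
  shows "\<exists>C. arith_prog (integer_mod_group n) C \<and> kl_sum_free (integer_mod_group n) k l C \<and> card C = m"
proof -
  have n: "0 < n" using kl m by (metis add_gr_0 gr0I le_zero_eq mult_is_0 not_less_zero)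
  have mn: "m \<le> n" using kl m by (metis add_gr_0 le_trans mult_le_mono1 nat_mult_1 Suc_leI One_nat_def)
  define q where "q = int k - int l"
  define lo where "lo = int l * (int m - 1) + 1"
  have q: "0 < \<bar>q\<bar>" using kl by (simp add: q_def)
  \<comment> \<open>\<open>w\<close> is the least multiple of \<open>k - l\<close> that is not below \<open>lo\<close>. It becomes \<open>(k - l) * a\<close>, and
    subtracting the \<open>l\<close> largest possible offsets from \<open>lo\<close> still leaves \<open>1\<close>.\<close>
  define w where "w = lo + (- lo) mod \<bar>q\<bar>"
  have w: "lo \<le> w" "w < lo + \<bar>q\<bar>" unfolding w_def using q by simp_all
  have "\<bar>q\<bar> dvd w" unfolding w_def by (simp add: dvd_eq_mod_eq_0 mod_simps)
  then obtain a where a: "w = q * a" by (auto elim: dvdE)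
  let ?I = "{a..a + int m - 1}"
  define C where "C = (\<lambda>x. x mod int n) ` ?I"
  have inj: "inj_on (\<lambda>x. x mod int n) ?I"
  proof (rule inj_onI)
    fix x y assume xy: "x \<in> ?I" "y \<in> ?I" "x mod int n = y mod int n"
    then have dvd: "int n dvd x - y" by (simp add: mod_eq_dvd_iff)
    show "x = y"
    proof (rule ccontr)
      assume "x \<noteq> y"
      then have "\<bar>int n\<bar> \<le> \<bar>x - y\<bar>" using dvd_imp_le_int[OF _ dvd] by simp
      then show False using xy mn by auto
    qed
  qed
  have "card C = m" unfolding C_def using inj by (simp add: card_image)
  moreover have "arith_prog (integer_mod_group n) C"
  proof -
    have "?I = (\<lambda>i. a + int i * 1) ` {..m - 1}"
    proof (intro equalityI subsetI)
      fix x assume "x \<in> ?I"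
      then show "x \<in> (\<lambda>i. a + int i * 1) ` {..m - 1}"
        by (intro image_eqI[of _ _ "nat (x - a)"]) auto
    qed (use m in auto)
    then have "C = (\<lambda>i. (a + int i * 1) mod int n) ` {..m - 1}"
      unfolding C_def by (simp add: image_image)
    then show ?thesis using arith_prog_integer_mod_group[OF n, of a 1 "m - 1"] by simp
  qed
  moreover have "kl_sum_free (integer_mod_group n) k l C"
    unfolding kl_sum_free_integer_mod_group[OF n]
  proof (intro conjI ballI notI)
    show "C \<subseteq> {0..<int n}" unfolding C_def using n by auto
    fix x y assume xy: "x \<in> nfold k C" "y \<in> nfold l C" "int n dvd x - y"
    have red: "\<exists>b\<in>?I. int n dvd c - b" if cC: "c \<in> C" for c
    proof -
      obtain b where "b \<in> ?I" "c = b mod int n" using cC unfolding C_def by auto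
      moreover have "int n dvd b mod int n - b" by (simp add: mod_eq_dvd_iff[symmetric])
      ultimately show ?thesis by blast
    qed
    obtain x' where x': "x' \<in> nfold k ?I" "int n dvd x - x'" using nfold_cong_mod[OF xy(1) red] by blast
    obtain y' where y': "y' \<in> nfold l ?I" "int n dvd y - y'" using nfold_cong_mod[OF xy(2) red] by blast
    have "int n dvd (x - y) - (x - x') + (y - y')"
      using dvd_add[OF dvd_diff[OF xy(3) x'(2)] y'(2)] .
    then have dvd: "int n dvd x' - y'" by simp
    have b: "int k * a \<le> x'" "x' \<le> int k * (a + int m - 1)" "int l * a \<le> y'" "y' \<le> int l * (a + int m - 1)"
      using nfold_interval_bounds[OF x'(1)] nfold_interval_bounds[OF y'(1)] by blast+
    have "q * a = int k * a - int l * a" by (simp add: q_def algebra_simps)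
    then have "0 < x' - y'"
      using b w(1) unfolding a lo_def by (simp add: algebra_simps)
    moreover have "x' - y' < int n"
    proof -
      have "x' - y' \<le> q * a + int k * (int m - 1)" using b by (simp add: q_def algebra_simps)
      also have "\<dots> < lo + \<bar>q\<bar> + int k * (int m - 1)" using w(2) a by simp
      also have "\<dots> = int ((k + l) * m) + (\<bar>q\<bar> - int k - int l) + 1"
        by (simp add: lo_def algebra_simps)
      also have "\<dots> \<le> int n" using m(2) kl unfolding q_def by linarith
      finally show ?thesis .
    qed
    ultimately show False using dvd zdvd_not_zless by blast
  qed
  ultimately show ?thesis by blast
qed

lemma card_residue_pullback:
  assumes n: "0 < n" and d: "d dvd n" and C: "C \<subseteq> {0..<int d}"
  shows "card {x \<in> {0..<int n}. x mod int d \<in> C} = card C * (n div d)"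
proof -
  obtain e where e: "n = d * e" using d by (elim dvdE)
  have pos: "0 < d" "0 < e" using n e by auto
  have "bij_betw (\<lambda>(r, j). r + int d * j) (C \<times> {0..<int e}) {x \<in> {0..<int n}. x mod int d \<in> C}"
  proof (rule bij_betw_byWitness[where f' = "\<lambda>x. (x mod int d, x div int d)"])
    show "\<forall>p\<in>C \<times> {0..<int e}. (\<lambda>x. (x mod int d, x div int d)) ((\<lambda>(r, j). r + int d * j) p) = p"
      using C pos by (auto simp: subset_iff)
    show "\<forall>x\<in>{x \<in> {0..<int n}. x mod int d \<in> C}. (\<lambda>(r, j). r + int d * j) (x mod int d, x div int d) = x"
      by simp
    show "(\<lambda>(r, j). r + int d * j) ` (C \<times> {0..<int e}) \<subseteq> {x \<in> {0..<int n}. x mod int d \<in> C}"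
    proof
      fix x assume "x \<in> (\<lambda>(r, j). r + int d * j) ` (C \<times> {0..<int e})"
      then obtain r j where rj: "x = r + int d * j" "r \<in> C" "0 \<le> j" "j < int e" by auto
      then have r: "0 \<le> r" "r < int d" using C by auto
      have "int d * (j + 1) \<le> int d * int e" using rj by (intro mult_left_mono) auto
      then show "x \<in> {x \<in> {0..<int n}. x mod int d \<in> C}"
        using r rj e by (simp add: algebra_simps)
    qed
    show "(\<lambda>x. (x mod int d, x div int d)) ` {x \<in> {0..<int n}. x mod int d \<in> C} \<subseteq> C \<times> {0..<int e}"
    proof
      fix p assume "p \<in> (\<lambda>x. (x mod int d, x div int d)) ` {x \<in> {0..<int n}. x mod int d \<in> C}"
      then obtain x where x: "p = (x mod int d, x div int d)" "0 \<le> x" "x < int n" "x mod int d \<in> C" by auto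
      have "x div int d < int e"
      proof (rule ccontr)
        assume "\<not> ?thesis"
        then have "int d * int e \<le> int d * (x div int d)" by (intro mult_left_mono) auto
        also have "\<dots> \<le> x" using pos pos_mod_sign[of "int d" x] mult_div_mod_eq[of "int d" x] by linarith
        finally show False using x e by simp
      qed
      then show "p \<in> C \<times> {0..<int e}" using x pos by (simp add: pos_imp_zdiv_nonneg_iff)
    qed
  qed
  from bij_betw_same_card[OF this]
  have "card {x \<in> {0..<int n}. x mod int d \<in> C} = card (C \<times> {0..<int e})" by simp
  then show ?thesis using e pos by (simp add: card_cartesian_product)
qed

lemma kl_sum_free_pullback:
  assumes n: "0 < n" and d: "d dvd n" and C: "kl_sum_free (integer_mod_group d) k l C"
  shows "\<exists>A. kl_sum_free (integer_mod_group n) k l A \<and> card A = card C * (n div d)"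
proof -
  have d0: "0 < d" using n d by (metis dvd_0_left_iff gr0I)
  let ?A = "{x \<in> {0..<int n}. x mod int d \<in> C}"
  have C': "C \<subseteq> {0..<int d}" "\<And>x y. x \<in> nfold k C \<Longrightarrow> y \<in> nfold l C \<Longrightarrow> \<not> int d dvd x - y"
    using C unfolding kl_sum_free_integer_mod_group[OF d0] by blast+
  have red: "\<exists>b\<in>C. int d dvd a - b" if "a \<in> ?A" for a
    using that by (intro bexI[of _ "a mod int d"]) auto
  have "kl_sum_free (integer_mod_group n) k l ?A"
    unfolding kl_sum_free_integer_mod_group[OF n]
  proof (intro conjI ballI notI)
    fix x y assume xy: "x \<in> nfold k ?A" "y \<in> nfold l ?A" "int n dvd x - y"
    obtain x' where x': "x' \<in> nfold k C" "int d dvd x - x'" using nfold_cong_mod[OF xy(1) red] by blast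
    obtain y' where y': "y' \<in> nfold l C" "int d dvd y - y'" using nfold_cong_mod[OF xy(2) red] by blast
    have "int d dvd x - y" using xy(3) d by (meson dvd_trans int_dvd_int_iff)
    from dvd_add[OF dvd_diff[OF this x'(2)] y'(2)] have "int d dvd (x - y) - (x - x') + (y - y')" .
    then show False using C'(2)[OF x'(1) y'(1)] by simp
  qed auto
  then show ?thesis using card_residue_pullback[OF n d C'(1)] by blast
qed

text \<open>
The first two cases of \<open>sum_free_trichotomy\<close> directly give a progression modulo \<open>n\<close>. In the third, the
residues of \<open>A\<close> modulo the proper divisor \<open>d\<close> of \<open>n\<close> that corresponds to \<open>H\<close> still form a sum-free set.
Each residue comes from at most \<open>n div d\<close> elements of \<open>A\<close>, and induction provides a progression for a
divisor of \<open>d\<close>.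
\<close>

lemma sum_free_le_progression:
  assumes "0 < n" and kl: "0 < k" "0 < l" "k \<noteq> l"
    and "kl_sum_free (integer_mod_group n) k l A" "A \<noteq> {}"
  shows "\<exists>d C. d dvd n \<and> arith_prog (integer_mod_group d) C \<and>
    kl_sum_free (integer_mod_group d) k l C \<and> card A \<le> card C * (n div d)"
  using assms(1,5,6)
proof (induction n arbitrary: A rule: less_induct)
  case (less n)
  note n = less.prems(1)
  have A: "A \<subseteq> {0..<int n}" "\<And>x y. x \<in> nfold k A \<Longrightarrow> y \<in> nfold l A \<Longrightarrow> \<not> int n dvd x - y"
    using less.prems(2) unfolding kl_sum_free_integer_mod_group[OF n] by blast+
  let ?r = "circle_frac n"
  have r0: "?r 0 = 0" using circle_frac_eq_0[OF n] by simp
  have r_diff: "?r (i - j) = ?r i - ?r j" for i j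
    using circle_frac_add[of n "i - j" j] by (simp add: algebra_simps)
  have r_eq: "?r i = ?r j \<longleftrightarrow> int n dvd i - j" for i j
    using circle_frac_eq_0[OF n, of "i - j"] by (simp add: r_diff)
  have r_mod: "?r (i mod int n) = ?r i" for i
    unfolding r_eq by (simp add: mod_eq_dvd_iff[symmetric])
  define G where "G = range ?r"
  have G_eq: "G = ?r ` {0..<int n}"
  proof -
    have "?r i \<in> ?r ` {0..<int n}" for i
      using n by (intro image_eqI[of _ _ "i mod int n"]) (simp_all add: r_mod)
    then show ?thesis unfolding G_def by auto
  qed
  have inj: "inj_on ?r {0..<int n}"
  proof (rule inj_onI)
    fix x y assume "x \<in> {0..<int n}" "y \<in> {0..<int n}" "?r x = ?r y"
    then show "x = y" unfolding r_eq by (metis atLeastLessThan_iff mod_eq_dvd_iff mod_pos_pos_trivial)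
  qed
  have G: "subgrp G" "finite G" "card G = n"
  proof -
    show "subgrp G"
      unfolding subgrp_def G_def
    proof (intro conjI ballI)
      show "0 \<in> range ?r" using r0 by (metis rangeI)
      fix x y assume "x \<in> range ?r" "y \<in> range ?r"
      then show "x - y \<in> range ?r" by (auto simp: r_diff[symmetric])
    qed
    show "finite G" "card G = n" unfolding G_eq by (simp_all add: card_image[OF inj])
  qed
  define B where "B = ?r ` A"
  have B: "B \<subseteq> G" "B \<noteq> {}" "card B = card A"
    using less.prems(3) card_image[OF inj_on_subset[OF inj A(1)]] by (auto simp: B_def G_def)
  have nB: "nfold h B = ?r ` nfold h A" for h
    unfolding B_def by (intro nfold_image_hom r0 circle_frac_add)
  have "nfold k B \<inter> nfold l B = {}"
    unfolding nB using A(2) r_eq by auto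
  from sum_free_trichotomy[OF G(1,2) B(1,2) kl(1,2) this]
  consider "\<exists>a\<in>G. \<exists>x\<in>G. \<exists>c. B = ap a x c" | "(k + l) * card A \<le> n"
    | H where "subgrp H" "H \<subseteq> G" "2 \<le> card H" "(nfold k B + H) \<inter> nfold l B = {}"
    unfolding B G by blast
  then show ?case
  proof cases
    case 1
    then obtain p q c where pq: "B = ap (?r p) (?r q) c" unfolding G_def by auto
    have it: "((+) (?r q) ^^ i) (?r p) = ?r (p + int i * q)" for i
      by (induction i) (simp_all add: circle_frac_add[symmetric] algebra_simps)
    have "?r ` A = ?r ` (\<lambda>i. (p + int i * q) mod int n) ` {..c}"
      using pq unfolding B_def ap_def it image_image r_mod .
    then have "A = (\<lambda>i. (p + int i * q) mod int n) ` {..c}"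
      using A n by (subst (asm) inj_on_image_eq_iff[OF inj]) auto
    then have "arith_prog (integer_mod_group n) A" using arith_prog_integer_mod_group[OF n] by simp
    then show ?thesis using less.prems n by (intro exI[of _ n] exI[of _ A]) simp
  next
    case 2
    have "0 < card A" using A(1) less.prems(3) finite_subset[of A "{0..<int n}"] by (simp add: card_gt_0_iff)
    from interval_progression[OF kl this 2] show ?thesis using n by (intro exI[of _ n]) auto
  next
    case (3 H)
    \<comment> \<open>The integers mapped into \<open>H\<close> are the multiples of the least positive one.\<close>
    define P where "P d \<longleftrightarrow> 0 < d \<and> ?r (int d) \<in> H" for d
    have Pn: "P n" unfolding P_def using n subgrp_zero[OF 3(1)] circle_frac_eq_0[OF n, of "int n"] by simp
    define d where "d = (LEAST d. P d)"
    have Pd: "P d" unfolding d_def using Pn by (rule LeastI)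
    then have d0: "0 < d" by (simp add: P_def)
    have mult: "?r (int d * j) \<in> H" for j
    proof (induction j rule: int_induct[of _ 0])
      case base
      then show ?case using r0 subgrp_zero[OF 3(1)] by simp
    next
      case (step1 i)
      then show ?case using Pd subgrp_add[OF 3(1)] by (simp add: P_def algebra_simps circle_frac_add)
    next
      case (step2 i)
      then show ?case using Pd subgrp_diff[OF 3(1)] by (simp add: P_def algebra_simps r_diff)
    qed
    have dvd_of_mem: "int d dvd i" if i: "?r i \<in> H" for i
    proof (rule ccontr)
      assume "\<not> int d dvd i"
      then have pos: "0 < i mod int d" using d0 by (metis dvd_eq_mod_eq_0 of_nat_0_less_iff order_le_less pos_mod_sign)
      have "?r (i mod int d) \<in> H"
        using subgrp_diff[OF 3(1) i mult[of "i div int d"]] by (simp add: r_diff[symmetric] minus_mult_div_eq_mod)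
      then have "P (nat (i mod int d))" using pos by (simp add: P_def)
      then have "d \<le> nat (i mod int d)" unfolding d_def by (rule Least_le)
      moreover have "i mod int d < int d" using d0 by simp
      ultimately show False using pos by linarith
    qed
    have dn: "d dvd n" using dvd_of_mem[of "int n"] Pn by (simp add: P_def)
    have "d \<noteq> n"
    proof
      assume "d = n"
      have "H \<subseteq> {0}"
      proof
        fix h assume "h \<in> H"
        then obtain i where "h = ?r i" using 3(2) unfolding G_def by blast
        then show "h \<in> {0}" using dvd_of_mem \<open>h \<in> H\<close> \<open>d = n\<close> circle_frac_eq_0[OF n] by simp
      qed
      then show False using 3(3) card_mono[of "{0}" H] by simp
    qed
    then have less_n: "d < n" using dn n dvd_imp_le by fastforce
    define A' where "A' = (\<lambda>x. x mod int d) ` A"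
    have red: "\<exists>b\<in>A. int d dvd a - b" if aA: "a \<in> A'" for a
    proof -
      obtain b where "b \<in> A" "a = b mod int d" using aA unfolding A'_def by auto
      moreover have "int d dvd b mod int d - b" by (simp add: mod_eq_dvd_iff[symmetric])
      ultimately show ?thesis by blast
    qed
    have A'd: "A' \<subseteq> {0..<int d}" using d0 unfolding A'_def by auto
    have "kl_sum_free (integer_mod_group d) k l A'"
      unfolding kl_sum_free_integer_mod_group[OF d0]
    proof (intro conjI ballI notI A'd)
      fix x y assume xy: "x \<in> nfold k A'" "y \<in> nfold l A'" "int d dvd x - y"
      obtain x' where x': "x' \<in> nfold k A" "int d dvd x - x'" using nfold_cong_mod[OF xy(1) red] by blast
      obtain y' where y': "y' \<in> nfold l A" "int d dvd y - y'" using nfold_cong_mod[OF xy(2) red] by blast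
      have "int d dvd (x - x') - (x - y) - (y - y')"
        using dvd_diff[OF dvd_diff[OF x'(2) xy(3)] y'(2)] .
      then have "int d dvd y' - x'" by simp
      then obtain j where "y' = x' + int d * j" by (metis dvdE add_diff_cancel_left' diff_add_cancel add.commute)
      then have "?r y' = ?r x' + ?r (int d * j)" by (simp add: circle_frac_add)
      then have "?r y' \<in> nfold k B + H"
        unfolding nB using mult[of j] x'(1) by auto
      moreover have "?r y' \<in> nfold l B"
        unfolding nB using y'(1) by blast
      ultimately show False using 3(4) by blast
    qed
    moreover have "A' \<noteq> {}" using less.prems(3) unfolding A'_def by simp
    ultimately obtain e C where C: "e dvd d" "arith_prog (integer_mod_group e) C"
      "kl_sum_free (integer_mod_group e) k l C" "card A' \<le> card C * (d div e)"
      using less.IH[OF less_n d0] by blast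
    have "card A \<le> card {x \<in> {0..<int n}. x mod int d \<in> A'}"
    proof (rule card_mono)
      show "finite {x \<in> {0..<int n}. x mod int d \<in> A'}" by (rule finite_Collect_conjI) simp
      show "A \<subseteq> {x \<in> {0..<int n}. x mod int d \<in> A'}" using A(1) unfolding A'_def by auto
    qed
    also have "\<dots> = card A' * (n div d)" by (rule card_residue_pullback[OF n dn A'd])
    also have "\<dots> \<le> card C * (d div e) * (n div d)" using C(4) by (intro mult_le_mono1)
    also have "\<dots> = card C * (n div e)"
      using C(1) dn d0 by (elim dvdE) auto
    finally show ?thesis using C dn dvd_trans by blast
  qed
qed

theorem theorem4:
  fixes k l n :: nat
  assumes "k > 0" and "l > 0" and "k \<noteq> l" and "n > 0"
  shows "lambda_kl k l (integer_mod_group n) =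
    Max {alpha_kl k l (integer_mod_group d) * (n div d) | d::nat. d dvd n}"
proof -
  have fin: "finite {card A | A. kl_sum_free (integer_mod_group d) k l A \<and> Q A}" if "0 < d" for d Q
  proof -
    have "{card A | A. kl_sum_free (integer_mod_group d) k l A \<and> Q A} \<subseteq> card ` Pow {0..<int d}"
      using that by (auto simp: kl_sum_free_integer_mod_group)
    then show ?thesis by (rule finite_subset) simp
  qed
  have fin_free: "finite {card A | A. kl_sum_free (integer_mod_group n) k l A}"
    using fin[of n "\<lambda>_. True"] assms(4) by simp
  have fin_ap: "finite {card A | A. arith_prog (integer_mod_group d) A \<and> kl_sum_free (integer_mod_group d) k l A}"
    if "0 < d" for d
    using fin[OF that, of "arith_prog (integer_mod_group d)"] by (simp add: conj_commute)
  let ?R = "{alpha_kl k l (integer_mod_group d) * (n div d) | d::nat. d dvd n}"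
  have finR: "finite ?R"
    using assms(4) finite_divisors_nat[of n] by (simp add: Setcompr_eq_image)
  have neR: "?R \<noteq> {}" by auto
  have "nfold k ({} :: int set) = {}" using assms(1) by (cases k) simp_all
  then have empty: "kl_sum_free (integer_mod_group n) k l {}"
    using assms(4) by (simp add: kl_sum_free_integer_mod_group)
  have "lambda_kl k l (integer_mod_group n) \<in> {card A | A. kl_sum_free (integer_mod_group n) k l A}"
    unfolding lambda_kl_def using fin_free empty by (intro Max_in) auto
  then obtain A where A: "kl_sum_free (integer_mod_group n) k l A"
    "lambda_kl k l (integer_mod_group n) = card A" by auto
  show ?thesis
  proof (rule antisym)
    show "lambda_kl k l (integer_mod_group n) \<le> Max ?R"
    proof (cases "A = {}")
      case True
      then show ?thesis using A by simp
    next
      case False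
      obtain d C where C: "d dvd n" "arith_prog (integer_mod_group d) C"
        "kl_sum_free (integer_mod_group d) k l C" "card A \<le> card C * (n div d)"
        using sum_free_le_progression[OF assms(4,1-3) A(1) False] by blast
      have d0: "0 < d" using C(1) assms(4) by (metis dvd_0_left_iff gr0I)
      have "card C \<le> alpha_kl k l (integer_mod_group d)"
        unfolding alpha_kl_def using C fin_ap[OF d0] by (auto intro!: Max_ge)
      then have "card A \<le> alpha_kl k l (integer_mod_group d) * (n div d)"
        using C(4) by (meson mult_le_mono1 order_trans)
      also have "\<dots> \<le> Max ?R" using finR C(1) by (intro Max_ge) auto
      finally show ?thesis using A(2) by simp
    qed
  next
    have "alpha_kl k l (integer_mod_group d) * (n div d) \<le> lambda_kl k l (integer_mod_group n)"
      if d: "d dvd n" for d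
    proof (cases "\<exists>C. arith_prog (integer_mod_group d) C \<and> kl_sum_free (integer_mod_group d) k l C")
      case True
      have d0: "0 < d" using d assms(4) by (metis dvd_0_left_iff gr0I)
      have "alpha_kl k l (integer_mod_group d)
        \<in> {card A | A. arith_prog (integer_mod_group d) A \<and> kl_sum_free (integer_mod_group d) k l A}"
        unfolding alpha_kl_def if_P[OF True] using fin_ap[OF d0] True by (intro Max_in) auto
      then obtain C where C: "kl_sum_free (integer_mod_group d) k l C"
        "alpha_kl k l (integer_mod_group d) = card C" by auto
      obtain D where D: "kl_sum_free (integer_mod_group n) k l D" "card D = card C * (n div d)"
        using kl_sum_free_pullback[OF assms(4) d C(1)] by blast
      have "card D \<le> lambda_kl k l (integer_mod_group n)"
        unfolding lambda_kl_def using fin_free D(1) by (intro Max_ge) auto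
      then show ?thesis using C D by simp
    next
      case False
      show ?thesis unfolding alpha_kl_def if_not_P[OF False] by simp
    qed
    then show "Max ?R \<le> lambda_kl k l (integer_mod_group n)"
      using finR neR by (subst Max_le_iff) auto
  qed
qed

end
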